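(* For every integer $m\ge 2$, let $\Gamma_m$ be the group presented by $$\langle\, a,s,t \mid [a,a^t]=1,\ [s,t]=1,\ a^s = a a^t,\ a^m=1 \,\rangle .$$ Then the Dehn function $\mathrm{Area}:\mathbb{N}\to\mathbb{N}$ of $\Gamma_m$ satisfies $\mathrm{Area}(n)\preceq n^4$.
   Context: Conventions: $[x,y]=x^{-1}y^{-1}xy$ and $x^{y}=y^{-1}xy$. For a finite presentation $\langle A\mid R\rangle$ and a word $w$ on $A^{\pm1}$ representing the identity, $\mathrm{Area}(w)$ is the minimal $N$ such that $w$ is freely equal to $\prod_{i=1}^N u_i^{-1}r_iu_i$ for some words $u_i$ on $A^{\pm1}$ and some $r_i\in R^{\pm1}$ (a relation $u=v$ is read as the relator $uv^{-1}$). The Dehn function $\mathrm{Area}(n)$ of $\langle A\mid R\rangle$ is the maximum of $\mathrm{Area}(w)$ over all words $w$ of length at most $n$ representing the identity. For $f,g:\mathbb{N}\to\mathbb{N}$, write $f\preceq g$ when there exists $C>0$ such that $f(n)\le C g(Cn+C)+Cn+C$ for all $n$; and $f\simeq g$ when $f\preceq g$ and $g\preceq f$. Up to $\simeq$, the Dehn function does not depend on the choice of finite presentation of the group. *)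

theory Defs
  imports "HOL-Algebra.Coset" "HOL-Algebra.Generated_Groups"
begin

text \<open>
  Words over an alphabet given by a type \<open>'a\<close>: the letter \<open>(x, True)\<close> stands for the generator
  \<open>x\<close> and \<open>(x, False)\<close> for its formal inverse.  Words are not assumed to be reduced.
\<close>

type_synonym 'a word = "('a \<times> bool) list"

definition gen :: "'a \<Rightarrow> 'a word" where
  "gen x = [(x, True)]"

definition inv_letter :: "'a \<times> bool \<Rightarrow> 'a \<times> bool" where
  "inv_letter l = (fst l, \<not> snd l)"

definition inv_word :: "'a word \<Rightarrow> 'a word" where
  "inv_word w = rev (map inv_letter w)"

definition conj_word :: "'a word \<Rightarrow> 'a word \<Rightarrow> 'a word" where
  "conj_word x y = inv_word y @ x @ y"

definition comm_word :: "'a word \<Rightarrow> 'a word \<Rightarrow> 'a word" where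
  "comm_word x y = inv_word x @ inv_word y @ x @ y"

definition pow_word :: "'a word \<Rightarrow> nat \<Rightarrow> 'a word" where
  "pow_word x k = concat (replicate k x)"

inductive cancel :: "'a word \<Rightarrow> 'a word \<Rightarrow> bool" where
  "cancel (u @ [l, inv_letter l] @ v) (u @ v)"

definition freely_equal :: "'a word \<Rightarrow> 'a word \<Rightarrow> bool" where
  "freely_equal = equivclp cancel"

definition word_class :: "'a word \<Rightarrow> 'a word set" where
  "word_class w = {v. freely_equal w v}"

definition free_group :: "'a word set monoid" where
  "free_group = \<lparr>carrier = range word_class,
                 mult = (\<lambda>X Y. \<Union>u\<in>X. \<Union>v\<in>Y. word_class (u @ v)),
                 one = word_class []\<rparr>"

definition normal_closure :: "('g, 'b) monoid_scheme \<Rightarrow> 'g set \<Rightarrow> 'g set" where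
  "normal_closure G S = generate G {inv\<^bsub>G\<^esub> g \<otimes>\<^bsub>G\<^esub> r \<otimes>\<^bsub>G\<^esub> g | g r. g \<in> carrier G \<and> r \<in> S}"

definition relator_subgroup :: "'a word set \<Rightarrow> 'a word set set" where
  "relator_subgroup R = normal_closure free_group (word_class ` R)"

text \<open>
  The group \<open>F(A)/\<langle>\<langle>R\<rangle>\<rangle>\<close>; its generating set \<open>A\<close> is the whole type \<open>'a\<close>.
\<close>

definition presented_group :: "'a word set \<Rightarrow> 'a word set set monoid" where
  "presented_group R = free_group Mod relator_subgroup R"

definition word_value :: "'a word set \<Rightarrow> 'a word \<Rightarrow> 'a word set set" where
  "word_value R w = relator_subgroup R #>\<^bsub>free_group\<^esub> word_class w"

definition represents_one :: "'a word set \<Rightarrow> 'a word \<Rightarrow> bool" where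
  "represents_one R w \<longleftrightarrow> word_value R w = \<one>\<^bsub>presented_group R\<^esub>"

definition product_of_conjugates :: "'a word set \<Rightarrow> nat \<Rightarrow> 'a word \<Rightarrow> bool" where
  "product_of_conjugates R N w \<longleftrightarrow>
     (\<exists>us rs. length us = N \<and> length rs = N \<and> set rs \<subseteq> R \<union> inv_word ` R \<and>
        freely_equal w (concat (map2 (\<lambda>u r. inv_word u @ r @ u) us rs)))"

text \<open>
  Only meaningful for words with \<open>represents_one R w\<close>; for these the set of admissible \<open>N\<close> is
  nonempty (lemma \<open>represents_one_iff_product\<close> below).
\<close>

definition area :: "'a word set \<Rightarrow> 'a word \<Rightarrow> nat" where
  "area R w = (LEAST N. product_of_conjugates R N w)"

text \<open>
  The alphabet is finite, so the maximum is taken over a finite set; it contains the empty word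
  (lemmas \<open>finite_null_words\<close> and \<open>represents_one_Nil\<close> below).
\<close>

definition dehn_function :: "('a::finite) word set \<Rightarrow> nat \<Rightarrow> nat" where
  "dehn_function R n = Max (area R ` {w. length w \<le> n \<and> represents_one R w})"

definition asymp_le :: "(nat \<Rightarrow> nat) \<Rightarrow> (nat \<Rightarrow> nat) \<Rightarrow> bool" (infix \<open>\<preceq>\<close> 50) where
  "f \<preceq> g \<longleftrightarrow> (\<exists>C>0. \<forall>n. f n \<le> C * g (C * n + C) + C * n + C)"

definition relator :: "'a word \<Rightarrow> 'a word \<Rightarrow> 'a word" where
  "relator u v = u @ inv_word v"

datatype ast = Gen_a | Gen_s | Gen_t

instance ast :: finite
proof
  have "(UNIV :: ast set) = {Gen_a, Gen_s, Gen_t}"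
    using ast.exhaust by auto
  then show "finite (UNIV :: ast set)"
    by (metis finite.emptyI finite.insertI)
qed

definition Gamma_relators :: "nat \<Rightarrow> ast word set" where
  "Gamma_relators m =
     (let a = gen Gen_a; s = gen Gen_s; t = gen Gen_t in
      {relator (comm_word a (conj_word a t)) [],
       relator (comm_word s t) [],
       relator (conj_word a s) (a @ conj_word a t),
       relator (pow_word a m) []})"


section \<open>Well-definedness\<close>

lemma freely_equal_refl [simp]: "freely_equal w w"
  by (simp add: freely_equal_def)

lemma freely_equal_sym: "freely_equal v w \<Longrightarrow> freely_equal w v"
  by (simp add: freely_equal_def equivclp_sym)

lemma freely_equal_trans [trans]:
  "freely_equal u v \<Longrightarrow> freely_equal v w \<Longrightarrow> freely_equal u w"
  unfolding freely_equal_def by (rule equivclp_trans)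

lemma cancel_append: "cancel u v \<Longrightarrow> cancel (x @ u @ y) (x @ v @ y)"
proof (induction rule: cancel.induct)
  case (1 u l v)
  show ?case using cancel.intros[of "x @ u" l "v @ y"] by simp
qed

lemma freely_equal_context: "freely_equal u v \<Longrightarrow> freely_equal (x @ u @ y) (x @ v @ y)"
  unfolding freely_equal_def
  by (induction rule: equivclp_induct) (auto intro: cancel_append equivclp_into_equivclp)

lemma freely_equal_append:
  assumes "freely_equal u u'" "freely_equal v v'"
  shows "freely_equal (u @ v) (u' @ v')"
  using freely_equal_trans[OF freely_equal_context[OF assms(1), of "[]" v]]
    freely_equal_context[OF assms(2), of u' "[]"]
  by simp

lemma inv_letter_inv_letter [simp]: "inv_letter (inv_letter l) = l"
  by (simp add: inv_letter_def)

lemma inv_word_inv_word [simp]: "inv_word (inv_word w) = w"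
  by (simp add: inv_word_def rev_map o_def)

lemma inv_word_append [simp]: "inv_word (u @ v) = inv_word v @ inv_word u"
  by (simp add: inv_word_def)

lemma inv_word_Nil [simp]: "inv_word [] = []"
  by (simp add: inv_word_def)

lemma freely_equal_right_inv: "freely_equal (w @ inv_word w) []"
proof (induction w)
  case (Cons l w)
  have "freely_equal ([l] @ (w @ inv_word w) @ [inv_letter l]) ([l] @ [] @ [inv_letter l])"
    by (rule freely_equal_context[OF Cons])
  also have "[l] @ [] @ [inv_letter l] = [] @ [l, inv_letter l] @ []"
    by simp
  also have "freely_equal \<dots> ([] @ [])"
    unfolding freely_equal_def by (intro r_into_equivclp cancel.intros)
  finally show ?case
    by (simp add: inv_word_def)
qed simp

lemma freely_equal_left_inv: "freely_equal (inv_word w @ w) []"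
  using freely_equal_right_inv[of "inv_word w"] by simp

lemma word_class_eq_iff: "word_class u = word_class v \<longleftrightarrow> freely_equal u v"
  unfolding word_class_def set_eq_iff mem_Collect_eq
  by (meson freely_equal_refl freely_equal_sym freely_equal_trans)

lemma free_group_mult [simp]:
  "word_class u \<otimes>\<^bsub>free_group\<^esub> word_class v = word_class (u @ v)"
proof -
  have "word_class (u' @ v') = word_class (u @ v)"
    if "u' \<in> word_class u" "v' \<in> word_class v" for u' v'
    using that freely_equal_append[of u u' v v', THEN freely_equal_sym]
    by (simp add: word_class_eq_iff) (simp add: word_class_def)
  moreover have "u \<in> word_class u" "v \<in> word_class v"
    by (simp_all add: word_class_def)
  ultimately have "(\<Union>u'\<in>word_class u. \<Union>v'\<in>word_class v. word_class (u' @ v')) = word_class (u @ v)"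
    by blast
  then show ?thesis
    by (simp add: free_group_def)
qed

lemma free_group_one [simp]: "\<one>\<^bsub>free_group\<^esub> = word_class []"
  by (simp add: free_group_def)

lemma free_group_carrier [simp]: "carrier free_group = range word_class"
  by (simp add: free_group_def)

lemma group_free_group: "group free_group"
proof (rule groupI)
  fix X assume "X \<in> carrier (free_group :: 'a word set monoid)"
  then obtain w where w: "X = word_class w" by auto
  have "word_class (inv_word w) \<otimes>\<^bsub>free_group\<^esub> X = \<one>\<^bsub>free_group\<^esub>"
    by (simp add: w word_class_eq_iff freely_equal_left_inv)
  then show "\<exists>Y\<in>carrier free_group. Y \<otimes>\<^bsub>free_group\<^esub> X = \<one>\<^bsub>free_group\<^esub>"
    by auto
qed auto

lemma free_group_inv [simp]: "inv\<^bsub>free_group\<^esub> (word_class w) = word_class (inv_word w)"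
  by (rule group.inv_equality[OF group_free_group])
     (auto simp: word_class_eq_iff freely_equal_left_inv)

lemma normal_closure_normal:
  fixes G (structure)
  assumes "group G" "S \<subseteq> carrier G"
  shows "normal_closure G S \<lhd> G"
proof -
  interpret group G by fact
  show ?thesis unfolding normal_closure_def
  proof (rule normal_generateI)
    show "{inv g \<otimes> r \<otimes> g |g r. g \<in> carrier G \<and> r \<in> S} \<subseteq> carrier G"
      using assms(2) by auto
  next
    fix h g
    assume h: "h \<in> {inv g \<otimes> r \<otimes> g |g r. g \<in> carrier G \<and> r \<in> S}" and g: "g \<in> carrier G"
    then obtain k r where k: "h = inv k \<otimes> r \<otimes> k" "k \<in> carrier G" "r \<in> S" by auto
    have r: "r \<in> carrier G" using k(3) assms(2) by auto
    have "g \<otimes> h \<otimes> inv g = inv (k \<otimes> inv g) \<otimes> r \<otimes> (k \<otimes> inv g)"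
      using k(1,2) r g by (simp add: inv_mult_group m_assoc)
    then show "g \<otimes> h \<otimes> inv g \<in> {inv g \<otimes> r \<otimes> g |g r. g \<in> carrier G \<and> r \<in> S}"
      using k(2,3) g by blast
  qed
qed

lemma relator_subgroup_normal: "relator_subgroup R \<lhd> free_group"
  unfolding relator_subgroup_def by (rule normal_closure_normal[OF group_free_group]) auto

lemma group_presented_group: "group (presented_group R)"
  unfolding presented_group_def by (rule normal.factorgroup_is_group[OF relator_subgroup_normal])

lemma represents_one_iff: "represents_one R w \<longleftrightarrow> word_class w \<in> relator_subgroup R"
proof -
  interpret group free_group by (rule group_free_group)
  have N: "subgroup (relator_subgroup R) free_group"
    by (rule normal_imp_subgroup[OF relator_subgroup_normal])
  show ?thesis
    unfolding represents_one_def word_value_def presented_group_def FactGroup_def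
    using coset_join1[OF _ _ N] coset_join2[OF _ N] subgroup.subset[OF N]
    by auto
qed

lemma represents_one_Nil: "represents_one R []"
  using subgroup.one_closed[OF normal_imp_subgroup[OF relator_subgroup_normal[of R]]]
  by (simp add: represents_one_iff)

lemma finite_null_words:
  "finite {w :: ('a::finite) word. length w \<le> n \<and> represents_one R w}"
  by (rule finite_subset[OF _ finite_lists_length_le[of UNIV n]]) auto

lemma product_of_conjugates_append:
  assumes "product_of_conjugates R M v" "product_of_conjugates R N w"
  shows "product_of_conjugates R (M + N) (v @ w)"
proof -
  let ?c = "\<lambda>us rs. concat (map2 (\<lambda>u r. inv_word u @ r @ u) us rs)"
  obtain us rs us' rs' where
    "length us = M" "length rs = M" "set rs \<subseteq> R \<union> inv_word ` R" "freely_equal v (?c us rs)"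
    "length us' = N" "length rs' = N" "set rs' \<subseteq> R \<union> inv_word ` R" "freely_equal w (?c us' rs')"
    using assms unfolding product_of_conjugates_def by (elim exE conjE)
  then show ?thesis
    unfolding product_of_conjugates_def
    by (intro exI[of _ "us @ us'"] exI[of _ "rs @ rs'"]) (simp add: freely_equal_append)
qed

lemma product_of_conjugates_cong:
  "freely_equal v w \<Longrightarrow> product_of_conjugates R N v \<Longrightarrow> product_of_conjugates R N w"
  unfolding product_of_conjugates_def
  by (elim exE conjE, intro exI conjI) (assumption+, erule (1) freely_equal_trans[OF freely_equal_sym])

lemma product_of_conjugates_1:
  "r \<in> R \<union> inv_word ` R \<Longrightarrow> product_of_conjugates R 1 (inv_word u @ r @ u)"
  unfolding product_of_conjugates_def
  by (intro exI[of _ "[u]"] exI[of _ "[r]"]) auto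

lemma represents_one_iff_product:
  "represents_one R w \<longleftrightarrow> (\<exists>N. product_of_conjugates R N w)"
proof
  let ?S = "{inv\<^bsub>free_group\<^esub> g \<otimes>\<^bsub>free_group\<^esub> r \<otimes>\<^bsub>free_group\<^esub> g | g r.
               g \<in> carrier free_group \<and> r \<in> word_class ` R}"
  have S: "\<exists>u r. r \<in> R \<and> h = word_class (inv_word u @ r @ u)" if hS: "h \<in> ?S" for h
  proof -
    obtain g r where "h = inv\<^bsub>free_group\<^esub> g \<otimes>\<^bsub>free_group\<^esub> word_class r \<otimes>\<^bsub>free_group\<^esub> g"
        "g \<in> carrier free_group" "r \<in> R"
      using hS by blast
    moreover from this obtain u where "g = word_class u"
      unfolding free_group_carrier by blast
    ultimately have "h = word_class (inv_word u @ r @ u)" "r \<in> R"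
      by simp_all
    then show ?thesis
      by blast
  qed
  have main: "\<forall>w. X = word_class w \<longrightarrow> (\<exists>N. product_of_conjugates R N w)"
    if "X \<in> generate free_group ?S" for X
    using that
  proof (induction rule: generate.induct)
    case one
    have "product_of_conjugates R 0 []"
      by (simp add: product_of_conjugates_def)
    then show ?case
      unfolding free_group_one word_class_eq_iff using product_of_conjugates_cong by blast
  next
    case (incl h)
    then obtain u r where "r \<in> R" "h = word_class (inv_word u @ r @ u)" using S by blast
    moreover have "product_of_conjugates R 1 (inv_word u @ r @ u)"
      using \<open>r \<in> R\<close> by (intro product_of_conjugates_1 UnI1)
    ultimately show ?case
      using product_of_conjugates_cong word_class_eq_iff by blast
  next
    case (inv h)
    then obtain u r where r: "r \<in> R" "h = word_class (inv_word u @ r @ u)" using S by blast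
    then have "inv\<^bsub>free_group\<^esub> h = word_class (inv_word u @ inv_word r @ u)"
      by simp
    moreover have "product_of_conjugates R 1 (inv_word u @ inv_word r @ u)"
      using r(1) by (intro product_of_conjugates_1 UnI2 imageI)
    ultimately show ?case
      using product_of_conjugates_cong word_class_eq_iff by metis
  next
    case (eng h1 h2)
    have "?S \<subseteq> carrier free_group"
    proof
      fix h assume "h \<in> ?S"
      then show "h \<in> carrier free_group" using S[of h] by auto
    qed
    then have "generate free_group ?S \<subseteq> carrier free_group"
      by (rule group.generate_incl[OF group_free_group])
    then have "h1 \<in> range word_class" "h2 \<in> range word_class"
      using eng.hyps unfolding free_group_carrier by (simp_all only: subset_iff)
    then obtain w1 w2 where w: "h1 = word_class w1" "h2 = word_class w2"
      by blast
    obtain M where "product_of_conjugates R M w1"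
      using eng.IH(1) w(1) by blast
    moreover obtain N where "product_of_conjugates R N w2"
      using eng.IH(2) w(2) by blast
    ultimately have "product_of_conjugates R (M + N) (w1 @ w2)"
      by (rule product_of_conjugates_append)
    moreover have "h1 \<otimes>\<^bsub>free_group\<^esub> h2 = word_class (w1 @ w2)"
      by (simp add: w)
    ultimately show ?case
      using product_of_conjugates_cong word_class_eq_iff by metis
  qed
  show "\<exists>N. product_of_conjugates R N w" if "represents_one R w"
  proof -
    have "word_class w \<in> generate free_group ?S"
      using that unfolding represents_one_iff relator_subgroup_def normal_closure_def .
    from main[OF this] show ?thesis by simp
  qed
next
  assume "\<exists>N. product_of_conjugates R N w"
  then obtain N where "product_of_conjugates R N w" ..
  then obtain us rs where
    us: "length us = N" "length rs = N" and rs: "set rs \<subseteq> R \<union> inv_word ` R" and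
    eq: "freely_equal w (concat (map2 (\<lambda>u r. inv_word u @ r @ u) us rs))"
    unfolding product_of_conjugates_def by (elim exE conjE)
  have len: "length us = length rs"
    using us by simp
  let ?N = "relator_subgroup R"
  have sub: "subgroup ?N free_group"
    by (rule normal_imp_subgroup[OF relator_subgroup_normal])
  have conj: "word_class (inv_word u @ r @ u) \<in> ?N" if "r \<in> R" for u r
  proof -
    have "word_class (inv_word u @ r @ u) =
        inv\<^bsub>free_group\<^esub> (word_class u) \<otimes>\<^bsub>free_group\<^esub> word_class r \<otimes>\<^bsub>free_group\<^esub> word_class u"
      by simp
    moreover have "word_class u \<in> carrier free_group" "word_class r \<in> word_class ` R"
      using that by auto
    ultimately show ?thesis
      unfolding relator_subgroup_def normal_closure_def
      by (intro generate.incl CollectI exI conjI)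
  qed
  have conj': "word_class (inv_word u @ inv_word r @ u) \<in> ?N" if "r \<in> R" for u r
    using subgroup.m_inv_closed[OF sub conj[OF that, of u]] by simp
  have "word_class (concat (map2 (\<lambda>u r. inv_word u @ r @ u) us rs)) \<in> ?N"
    using len rs
  proof (induction us rs rule: list_induct2)
    case Nil
    show ?case using subgroup.one_closed[OF sub] by simp
  next
    case (Cons u us r rs)
    then have "word_class (inv_word u @ r @ u) \<in> ?N" using conj conj' by auto
    moreover have "word_class (concat (map2 (\<lambda>u r. inv_word u @ r @ u) us rs)) \<in> ?N"
      using Cons by simp
    ultimately have "word_class (inv_word u @ r @ u) \<otimes>\<^bsub>free_group\<^esub>
        word_class (concat (map2 (\<lambda>u r. inv_word u @ r @ u) us rs)) \<in> ?N"
      by (rule subgroup.m_closed[OF sub])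
    then show ?case
      by simp
  qed
  moreover have "word_class w = word_class (concat (map2 (\<lambda>u r. inv_word u @ r @ u) us rs))"
    using eq unfolding word_class_eq_iff .
  ultimately show "represents_one R w"
    unfolding represents_one_iff by simp
qed

end

theory Submission
  imports Defs "HOL-Computational_Algebra.Formal_Laurent_Series"
begin

text \<open>
  Let \<open>y = 1 + x\<close>.  In \<open>\<Gamma>\<^sub>m\<close> the conjugates of \<open>a\<close> generate the additive group of the ring
  \<open>\<int>/m[x, 1/x, 1/y]\<close>, where \<open>a\<close> is \<open>1\<close> and conjugation by \<open>t\<close> and \<open>s\<close> is multiplication by
  \<open>x\<close> and \<open>y\<close>; the relation \<open>a^s = a a^t\<close> says that \<open>y = 1 + x\<close>.  The polynomial with coefficients
  \<open>f(0), \<dots>, f(n-1)\<close> is represented by the Horner word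
  \<open>a^f(0) t\<^sup>-\<^sup>1 a^f(1) t\<^sup>-\<^sup>1 \<dots> a^f(n-1) t\<^sup>-\<^sup>1 t^n\<close>.  Its length is linear in \<open>n\<close>, because the relation
  \<open>a^m = 1\<close> keeps the exponents below \<open>m\<close>.

  A word \<open>w\<close> of length \<open>n\<close> is filled by reading it from a distant starting point: it is preceded by
  \<open>t^(-n) s^(-n)\<close>, so that each of its letters \<open>a\<close> contributes \<open>\<plusminus>x\<^sup>i y\<^sup>j\<close> with \<open>0 \<le> i, j \<le> 2n\<close>, a
  polynomial of degree at most \<open>4n\<close>.  These polynomials are absorbed one after the other into a
  single Horner word (\<open>collect_letters\<close>).  If \<open>w\<close> represents the identity, the Horner word that is
  left at the end represents \<open>0\<close>; all its coefficients are then divisible by \<open>m\<close>, and it is freely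
  trivial (\<open>horner_eq_0_of_near\<close>).

  The heart of the matter is that two Horner words can be added at quadratic cost (\<open>horner_add\<close>).
  Collecting equal powers of \<open>x\<close> letter by letter would require commutators of \<open>a\<close> with \<open>a^(t^k)\<close> for
  large \<open>k\<close>, and the obvious fillings of these, by induction on \<open>k\<close>, grow exponentially.  Instead,
  let \<open>W(f)\<close> be the Horner word of \<open>f\<close> without the final \<open>t^n\<close>.  The element \<open>W(f + k)\<^sup>-\<^sup>1 W(f)\<close> of \<open>\<Gamma>\<^sub>m\<close>
  is \<open>t^n (-k) t^(-n)\<close> and so depends on \<open>k\<close> only; once this is known at quadratic cost
  (\<open>steps_t_difference\<close>), it follows that \<open>W(f) W(0)\<^sup>-\<^sup>1 = W(f + g) W(g)\<^sup>-\<^sup>1\<close>, and appending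
  \<open>W(g) W(0)\<^sup>-\<^sup>1\<close> makes \<open>W(g)\<close> cancel.

  The quadratic filling comes from two families of relations of bounded area,
  \<open>a^c t\<^sup>-\<^sup>1 a^d s\<^sup>-\<^sup>1 = a^(c-d) s\<^sup>-\<^sup>1 a^d t\<^sup>-\<^sup>1\<close> (\<open>exchange_steps\<close>) and \<open>a^c t\<^sup>-\<^sup>1 t a^d s\<^sup>-\<^sup>1 = a^(c+d) s\<^sup>-\<^sup>1\<close>
  (\<open>step_t_step_ts\<close>).  Geometrically, with respect to the elements \<open>a^c t\<^sup>-\<^sup>1\<close>, \<open>a^c s\<^sup>-\<^sup>1\<close>,
  \<open>t a^c s\<^sup>-\<^sup>1\<close> the group \<open>\<Gamma>\<^sub>m\<close> looks like a horocyclic product of three trees: in each step one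
  coordinate moves to its parent and another one to a child.  A Horner word moves the first coordinate
  up and down again, while the second compensates by a descent and the return from it.  Such a
  compensation can be handed over to the third coordinate, across a triangle tiled by the squares
  and triangles of the two families; and then back to the second along any other descent.

  Each of the \<open>n\<close> letters costs \<open>O(n\<^sup>2)\<close>, so that the area is in fact at most cubic.

  Groups are written additively although they are not commutative: the type class
  \<open>group_add\<close> then lets the simplifier decide equality in free groups.
\<close>

section \<open>The free group as a type\<close>

lemma freely_equal_inv_word: "freely_equal u v \<Longrightarrow> freely_equal (inv_word u) (inv_word v)"
  by (metis free_group_inv word_class_eq_iff)

quotient_type 'a fgrp = "'a word" / freely_equal
  by (intro equivpI reflpI sympI transpI) (auto intro: freely_equal_sym freely_equal_trans)

instantiation fgrp :: (type) group_add
begin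

lift_definition zero_fgrp :: "'a fgrp" is "[]" .

lift_definition plus_fgrp :: "'a fgrp \<Rightarrow> 'a fgrp \<Rightarrow> 'a fgrp" is "(@)"
  by (rule freely_equal_append)

lift_definition uminus_fgrp :: "'a fgrp \<Rightarrow> 'a fgrp" is inv_word
  by (rule freely_equal_inv_word)

definition minus_fgrp :: "'a fgrp \<Rightarrow> 'a fgrp \<Rightarrow> 'a fgrp" where
  "minus_fgrp g h = g + - h"

instance
proof
  fix g h k :: "'a fgrp"
  show "g + h + k = g + (h + k)" by transfer simp
  show "0 + g = g" by transfer simp
  show "g + 0 = g" by transfer simp
  show "- g + g = 0" by transfer (rule freely_equal_left_inv)
  show "g + - h = g - h" by (simp only: minus_fgrp_def)
qed

end

lift_definition cls :: "'a word \<Rightarrow> 'a fgrp" is "\<lambda>w. w" .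

lemma cls_Nil: "cls [] = 0"
  by transfer simp

lemma cls_append: "cls (u @ v) = cls u + cls v"
  by transfer simp

lemma cls_inv_word: "cls (inv_word w) = - cls w"
  by transfer simp

lemma cls_eq_iff: "cls u = cls v \<longleftrightarrow> freely_equal u v"
  by transfer simp

lemma cls_surj: "\<exists>w. g = cls w"
  by transfer (meson freely_equal_refl)

text \<open>
  Oriented from left to right, these equations bring both sides of an identity that holds in every
  group to the same reduced form.
\<close>

lemmas group_normalize = add.assoc diff_conv_add_uminus minus_add minus_minus minus_zero
  minus_add_cancel add_minus_cancel left_minus right_minus add_0_left add_0_right

section \<open>The bi-invariant distance\<close>

text \<open>
  The relation \<open>product_of_conjugates\<close> between relators and words, carried over to any group.
\<close>

inductive conj_prod :: "'g::group_add set \<Rightarrow> nat \<Rightarrow> 'g \<Rightarrow> bool" for R where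
  zero: "conj_prod R 0 0"
| pos: "r \<in> R \<Longrightarrow> conj_prod R n g \<Longrightarrow> conj_prod R (Suc n) (- u + r + u + g)"
| neg: "r \<in> R \<Longrightarrow> conj_prod R n g \<Longrightarrow> conj_prod R (Suc n) (- u + - r + u + g)"

lemma conj_prod_add: "conj_prod R p g \<Longrightarrow> conj_prod R q h \<Longrightarrow> conj_prod R (p + q) (g + h)"
proof (induction rule: conj_prod.induct)
  case (pos r n g u)
  then show ?case using conj_prod.pos[of r R "n + q" "g + h" u] by (simp add: add.assoc)
next
  case (neg r n g u)
  then show ?case using conj_prod.neg[of r R "n + q" "g + h" u] by (simp add: add.assoc)
qed simp

lemma conj_prod_one:
  assumes "r \<in> R"
  shows "conj_prod R 1 (- u + r + u)" "conj_prod R 1 (- u + - r + u)"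
  using conj_prod.pos[OF assms conj_prod.zero, of u] conj_prod.neg[OF assms conj_prod.zero, of u]
  by simp_all

lemma conj_prod_uminus: "conj_prod R p g \<Longrightarrow> conj_prod R p (- g)"
proof (induction rule: conj_prod.induct)
  case zero
  show ?case using conj_prod.zero by simp
next
  case (pos r n g u)
  have "- (- u + r + u + g) = - g + (- u + - r + u)"
    by (simp only: group_normalize)
  then show ?case
    using conj_prod_add[OF pos.IH conj_prod_one(2)[OF pos.hyps(1), of u]] by simp
next
  case (neg r n g u)
  have "- (- u + - r + u + g) = - g + (- u + r + u)"
    by (simp only: group_normalize)
  then show ?case
    using conj_prod_add[OF neg.IH conj_prod_one(1)[OF neg.hyps(1), of u]] by simp
qed

lemma conj_prod_conj: "conj_prod R p g \<Longrightarrow> conj_prod R p (x + g + - x)"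
proof (induction rule: conj_prod.induct)
  case zero
  show ?case using conj_prod.zero by simp
next
  case (pos r n g u)
  have "x + (- u + r + u + g) + - x = - (u + - x) + r + (u + - x) + (x + g + - x)"
    by (simp only: group_normalize)
  then show ?case
    using conj_prod.pos[OF pos.hyps(1) pos.IH, of "u + - x"] by simp
next
  case (neg r n g u)
  have "x + (- u + - r + u + g) + - x = - (u + - x) + - r + (u + - x) + (x + g + - x)"
    by (simp only: group_normalize)
  then show ?case
    using conj_prod.neg[OF neg.hyps(1) neg.IH, of "u + - x"] by simp
qed

text \<open>
  The distance from \<open>g\<close> to \<open>h\<close> is the number of relators needed to rewrite \<open>g\<close> into \<open>h\<close>.  It is
  invariant under translations from both sides, so that rewriting a factor of a product costs the
  same wherever the factor stands; the area of a word is its distance from \<open>0\<close>.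
\<close>

definition near :: "'g::group_add set \<Rightarrow> nat \<Rightarrow> 'g \<Rightarrow> 'g \<Rightarrow> bool" where
  "near R N g h \<longleftrightarrow> (\<exists>n\<le>N. conj_prod R n (g - h))"

lemma near_refl [simp]: "near R N g g"
  unfolding near_def using conj_prod.zero by (intro exI[of _ 0]) simp

lemma near_mono: "near R M g h \<Longrightarrow> M \<le> N \<Longrightarrow> near R N g h"
  unfolding near_def using le_trans by blast

lemma near_sym: "near R N g h \<Longrightarrow> near R N h g"
  unfolding near_def using conj_prod_uminus by (metis minus_diff_eq)

lemma near_trans:
  assumes "near R M g h" "near R N h k"
  shows "near R (M + N) g k"
proof -
  obtain p q where "p \<le> M" "conj_prod R p (g - h)" "q \<le> N" "conj_prod R q (h - k)"
    using assms unfolding near_def by blast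
  moreover have "(g - h) + (h - k) = g - k"
    by (simp only: group_normalize)
  ultimately show ?thesis
    unfolding near_def using conj_prod_add by (metis add_mono)
qed

lemma near_trans':
  "near R M g h \<Longrightarrow> near R N h k \<Longrightarrow> M + N \<le> Q \<Longrightarrow> near R Q g k"
  using near_trans near_mono by blast

lemma near_context:
  assumes "near R N g h"
  shows "near R N (x + g + y) (x + h + y)"
proof -
  have "(x + g + y) - (x + h + y) = x + (g - h) + - x"
    by (simp only: group_normalize)
  then show ?thesis
    using assms conj_prod_conj unfolding near_def by metis
qed

lemma near_add_left: "near R N g h \<Longrightarrow> near R N (x + g) (x + h)"
  using near_context[of R N g h x 0] by simp

lemma near_add_right: "near R N g h \<Longrightarrow> near R N (g + y) (h + y)"
  using near_context[of R N g h 0 y] by simp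

lemma near_add:
  "near R M g g' \<Longrightarrow> near R N h h' \<Longrightarrow> near R (M + N) (g + h) (g' + h')"
  using near_trans[OF near_add_right near_add_left] .

lemma near_relator: "u - v \<in> R \<Longrightarrow> near R 1 u v"
  unfolding near_def using conj_prod_one(1)[of "u - v" R 0] by auto

section \<open>Area as distance from the identity\<close>

lemma conj_prod_imp_product_of_conjugates:
  assumes "conj_prod (cls ` R) n g" "g = cls w"
  shows "product_of_conjugates R n w"
  using assms
proof (induction arbitrary: w rule: conj_prod.induct)
  case zero
  then have "freely_equal [] w"
    by (simp add: cls_eq_iff flip: cls_Nil)
  moreover have "product_of_conjugates R 0 []"
    by (simp add: product_of_conjugates_def)
  ultimately show ?case
    by (rule product_of_conjugates_cong)
next
  case (pos r n g u)
  obtain u' where u': "u = cls u'" using cls_surj by blast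
  obtain g' where g': "g = cls g'" using cls_surj by blast
  obtain r' where r': "r = cls r'" "r' \<in> R" using pos.hyps by blast
  have "product_of_conjugates R (1 + n) ((inv_word u' @ r' @ u') @ g')"
    using pos.IH[OF g'] r' by (intro product_of_conjugates_append product_of_conjugates_1) auto
  moreover have "cls ((inv_word u' @ r' @ u') @ g') = cls w"
    using pos.prems by (simp only: u' g' r' cls_append cls_inv_word add.assoc)
  ultimately show ?case
    unfolding cls_eq_iff plus_1_eq_Suc by (rule product_of_conjugates_cong[rotated])
next
  case (neg r n g u)
  obtain u' where u': "u = cls u'" using cls_surj by blast
  obtain g' where g': "g = cls g'" using cls_surj by blast
  obtain r' where r': "r = cls r'" "r' \<in> R" using neg.hyps by blast
  have "product_of_conjugates R (1 + n) ((inv_word u' @ inv_word r' @ u') @ g')"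
    using neg.IH[OF g'] r' by (intro product_of_conjugates_append product_of_conjugates_1) auto
  moreover have "cls ((inv_word u' @ inv_word r' @ u') @ g') = cls w"
    using neg.prems by (simp only: u' g' r' cls_append cls_inv_word add.assoc)
  ultimately show ?case
    unfolding cls_eq_iff plus_1_eq_Suc by (rule product_of_conjugates_cong[rotated])
qed

lemma area_le_of_near:
  assumes "near (cls ` R) N (cls w) 0"
  shows "area R w \<le> N"
proof -
  obtain n where "n \<le> N" "conj_prod (cls ` R) n (cls w)"
    using assms unfolding near_def by auto
  then have "product_of_conjugates R n w"
    using conj_prod_imp_product_of_conjugates by blast
  then show ?thesis
    using Least_le[of "\<lambda>N. product_of_conjugates R N w" n] \<open>n \<le> N\<close> by (simp add: area_def)
qed

lemma conj_prod_of_product: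
  assumes "length us = length rs" "set rs \<subseteq> R \<union> inv_word ` R"
  shows "conj_prod (cls ` R) (length rs) (cls (concat (map2 (\<lambda>u r. inv_word u @ r @ u) us rs)))"
  using assms
proof (induction us rs rule: list_induct2)
  case Nil
  show ?case by (simp add: cls_Nil conj_prod.zero)
next
  case (Cons u us r rs)
  let ?g = "cls (concat (map2 (\<lambda>u r. inv_word u @ r @ u) us rs))"
  have IH: "conj_prod (cls ` R) (length rs) ?g"
    using Cons by auto
  have eq: "cls (concat (map2 (\<lambda>u r. inv_word u @ r @ u) (u # us) (r # rs)))
      = - cls u + cls r + cls u + ?g"
    by (simp add: cls_append cls_inv_word add.assoc)
  consider "r \<in> R" | r' where "r' \<in> R" "r = inv_word r'"
    using Cons.prems by auto
  then show ?case
  proof cases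
    case 1
    then show ?thesis
      unfolding eq using conj_prod.pos[OF imageI IH] by simp
  next
    case 2
    then show ?thesis
      unfolding eq using conj_prod.neg[OF imageI IH] by (simp add: cls_inv_word)
  qed
qed

lemma near_of_represents_one:
  assumes "represents_one R w"
  shows "\<exists>N. near (cls ` R) N (cls w) 0"
proof -
  obtain N us rs where "length us = N" "length rs = N" "set rs \<subseteq> R \<union> inv_word ` R"
     "freely_equal w (concat (map2 (\<lambda>u r. inv_word u @ r @ u) us rs))"
    using assms unfolding represents_one_iff_product product_of_conjugates_def by (elim exE conjE)
  then have "conj_prod (cls ` R) N (cls w)"
    using conj_prod_of_product[of us rs R] by (simp add: cls_eq_iff[symmetric])
  then show ?thesis
    unfolding near_def by auto
qed

section \<open>Multiples in a non-commutative group\<close>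

primrec nmul :: "nat \<Rightarrow> 'g::monoid_add \<Rightarrow> 'g" where
  "nmul 0 g = 0"
| "nmul (Suc n) g = g + nmul n g"

lemma nmul_add: "nmul (p + q) g = nmul p g + nmul q g"
  by (induction p) (simp_all add: add.assoc)

lemma nmul_Suc_right: "nmul (Suc n) g = nmul n g + g"
  using nmul_add[of n 1 g] by simp

lemma nmul_uminus: "nmul n (- g) = - nmul n (g :: 'g::group_add)"
proof (induction n)
  case (Suc n)
  have "nmul (Suc n) (- g) = nmul n (- g) + - g"
    by (rule nmul_Suc_right)
  then show ?case
    using Suc by (simp only: nmul.simps(2)[of n g] minus_add)
qed simp

lemma nmul_conj: "nmul n (- x + g + x) = - x + nmul n g + (x :: 'g::group_add)"
proof (induction n)
  case (Suc n)
  then show ?case by (simp only: nmul.simps group_normalize)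
qed simp

lemma near_nmul_commute:
  assumes "near R N (g + h) (h + g)"
  shows "near R (n * N) (nmul n g + h) (h + nmul n g)"
proof (induction n)
  case (Suc n)
  have "near R (n * N) (g + (nmul n g + h)) (g + (h + nmul n g))"
    using Suc by (rule near_add_left)
  moreover have "near R N ((g + h) + nmul n g) ((h + g) + nmul n g)"
    using assms by (rule near_add_right)
  ultimately show ?case
    using near_trans'[of R "n * N" _ "g + (h + nmul n g)" N] by (simp add: add.assoc)
qed simp

lemma near_nmul_plus:
  assumes "near R 1 (g + h) (h + g)"
  shows "near R (n * n) (nmul n (g + h)) (nmul n g + nmul n h)"
proof (induction n)
  case (Suc n)
  have "near R (n * n) (nmul n (g + h) + (g + h)) (nmul n g + nmul n h + (g + h))"
    using Suc by (rule near_add_right)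
  moreover have "near R n (nmul n g + (nmul n h + g) + h) (nmul n g + (g + nmul n h) + h)"
    using near_nmul_commute[OF near_sym[OF assms], of n] by (intro near_context) simp
  ultimately have "near R (n * n + n) (nmul n (g + h) + (g + h)) (nmul n g + g + (nmul n h + h))"
    using near_trans'[of R "n * n" _ "nmul n g + nmul n h + (g + h)" n] by (simp add: add.assoc)
  then show ?case
    unfolding nmul_Suc_right by (rule near_mono) simp
qed simp

section \<open>Steps and Horner words\<close>

text \<open>
  The relations of \<open>\<Gamma>\<^sub>m\<close>, each at distance one, in an arbitrary group; \<open>- t + a + t\<close> is \<open>a^t\<close>.
\<close>

locale baumslag_relations =
  fixes R :: "'g::group_add set" and a s t :: 'g and m :: nat
  assumes m: "m \<ge> 2"
    and a_at: "near R 1 (a + (- t + a + t)) (- t + a + t + a)"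
    and s_t: "near R 1 (s + t) (t + s)"
    and as: "near R 1 (- s + a + s) (a + (- t + a + t))"
    and am: "near R 1 (nmul m a) 0"
begin

text \<open>
  Reducing every exponent modulo \<open>m\<close> at once keeps the cost of all later relations bounded, whatever
  the integer \<open>c\<close> is, and makes \<open>digit c\<close> literally \<open>0\<close> when \<open>m\<close> divides \<open>c\<close>.
\<close>

definition digit :: "int \<Rightarrow> 'g" where
  "digit c = nmul (nat (c mod int m)) a"

definition step_t :: "int \<Rightarrow> 'g" where
  "step_t c = digit c - t"

definition step_s :: "int \<Rightarrow> 'g" where
  "step_s c = digit c - s"

definition step_ts :: "int \<Rightarrow> 'g" where
  "step_ts c = t + digit c - s"

definition steps_t :: "int list \<Rightarrow> 'g" where
  "steps_t f = sum_list (map step_t f)"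

definition steps_ts :: "int list \<Rightarrow> 'g" where
  "steps_ts d = sum_list (map step_ts d)"

definition horner :: "int list \<Rightarrow> 'g" where
  "horner f = steps_t f + nmul (length f) t"

text \<open>
  A bound for the area of the relations in \<open>exchange_steps\<close>.
\<close>

definition cost :: nat where
  "cost = (m + 2)\<^sup>2"

lemma cost_ge_1: "cost \<ge> 1"
  unfolding cost_def by simp

lemma digit_0 [simp]: "digit 0 = 0"
  by (simp add: digit_def)

lemma digit_1: "digit 1 = a"
  using m by (simp add: digit_def)

lemma digit_add: "near R 1 (digit c + digit d) (digit (c + d))"
proof -
  define p q r where "p = nat (c mod int m)" and "q = nat (d mod int m)"
    and "r = nat ((c + d) mod int m)"
  have "(c + d) mod int m = (c mod int m + d mod int m) mod int m"
    by (simp add: mod_add_eq)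
  then have "r = (p + q) mod m"
    using m unfolding p_def q_def r_def
    by (simp add: nat_mod_distrib nat_add_distrib)
  moreover have "p < m" "q < m"
    using m unfolding p_def q_def by (simp_all add: nat_less_iff)
  ultimately have "p + q = r \<or> p + q = r + m"
    by (auto simp: mod_if)
  moreover have "digit c + digit d = nmul (p + q) a" "digit (c + d) = nmul r a"
    unfolding digit_def p_def q_def r_def by (simp_all add: nmul_add)
  moreover have "near R 1 (nmul (r + m) a) (nmul r a)"
    using near_add_left[OF am, of "nmul r a"] by (simp add: nmul_add)
  ultimately show ?thesis
    by auto
qed

lemma digit_uminus: "near R 1 (digit (- c)) (- digit c)"
  using near_add_right[OF digit_add[of "- c" c], of "- digit c"] by (simp add: add.assoc)

lemma t_s: "near R 1 (t + - s) (- s + t)"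
  using near_context[OF s_t, of "- s" "- s"]
  by (simp only: group_normalize)

text \<open>
  Both sides carry the same ring element, since \<open>c + d x = (c - d) + d y\<close>.  A filling needs \<open>a^s = a a^t\<close>
  for each of the letters of \<open>digit d\<close>, the commutation of the neighbours \<open>a\<close> and \<open>a^t\<close>, and \<open>[s, t] = 1\<close>;
  as \<open>digit d\<close> has fewer than \<open>m\<close> letters, the cost depends on \<open>m\<close> alone.
\<close>

lemma exchange_steps: "near R cost (step_t c + step_s d) (step_s (c - d) + step_t d)"
proof -
  define k where "k = nat (d mod int m)"
  have "k \<le> m"
    using m unfolding k_def by (simp add: nat_le_iff order_less_imp_le)
  have Ad: "digit d = nmul k a"
    by (simp add: digit_def k_def)
  have "near R (k * 1) (nmul k (- s + a + s)) (nmul k (a + (- t + a + t)))" for k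
  proof (induction k)
    case (Suc k)
    show ?case
      using near_add[OF as Suc] by simp
  qed simp
  then have "near R k (- s + nmul k a + s) (nmul k (a + (- t + a + t)))"
    by (simp add: nmul_conj)
  moreover have "near R (k * k) (nmul k (a + (- t + a + t))) (nmul k a + (- t + nmul k a + t))"
    using near_nmul_plus[OF a_at, of k]
    by (simp add: nmul_conj)
  ultimately have "near R (k + k * k) (- s + nmul k a + s) (nmul k a + (- t + nmul k a + t))"
    by (rule near_trans)
  then have "near R (k + k * k) (- s + nmul k a + s + (- s + - t))
      (nmul k a + (- t + nmul k a + t) + (- s + - t))"
    by (rule near_add_right)
  then have "near R (k + k * k) (- s + (digit d + - t)) (digit d + - t + digit d + (t + - s) + - t)"
    by (simp only: group_normalize Ad)
  moreover have "near R 1 (digit d + - t + digit d + (t + - s) + - t) (digit d + - t + digit d + (- s + t) + - t)"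
    by (intro near_context t_s)
  ultimately have *: "near R (k + k * k + 1) (- s + (digit d + - t)) (digit d + (- t + (digit d + - s)))"
    using near_trans by (fastforce simp only: group_normalize)
  have "near R (k + k * k + 1) (digit (c - d) + (- s + (digit d + - t)))
      (digit (c - d) + (digit d + (- t + (digit d + - s))))"
    by (rule near_add_left) (rule *)
  moreover have "near R 1 ((digit (c - d) + digit d) + (- t + (digit d + - s))) (digit c + (- t + (digit d + - s)))"
    using digit_add[of "c - d" d] by (intro near_add_right) simp
  ultimately have "near R (k + k * k + 1 + 1) (digit (c - d) + (- s + (digit d + - t)))
      (digit c + (- t + (digit d + - s)))"
    using near_trans by (fastforce simp only: group_normalize)
  then have "near R (k + k * k + 1 + 1) (step_s (c - d) + step_t d) (step_t c + step_s d)"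
    by (simp only: group_normalize step_s_def step_t_def)
  moreover have "k + k * k + 1 + 1 \<le> cost"
    using \<open>k \<le> m\<close> mult_le_mono[OF \<open>k \<le> m\<close> \<open>k \<le> m\<close>]
    by (simp add: cost_def power2_eq_square)
  ultimately show ?thesis
    using near_sym near_mono by blast
qed

lemma step_t_step_ts: "near R 1 (step_t c + step_ts d) (step_s (c + d))"
  using near_add_right[OF digit_add[of c d], of "- s"]
  unfolding step_t_def step_ts_def step_s_def by (simp only: group_normalize)

lemma steps_t_simps [simp]:
  "steps_t [] = 0" "steps_t (c # f) = step_t c + steps_t f" "steps_t (f @ g) = steps_t f + steps_t g"
  unfolding steps_t_def by simp_all

lemma steps_ts_simps [simp]:
  "steps_ts [] = 0" "steps_ts (c # f) = step_ts c + steps_ts f"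
  unfolding steps_ts_def by simp_all

text \<open>
  When a step \<open>step_s e\<close> behind \<open>steps_t f\<close> is exchanged with all of these steps, it arrives in front as
  \<open>step_s (fst (push f e))\<close>, and the digits left behind are \<open>snd (push f e)\<close>.  This map is additive in
  both arguments together, so that differences travel independently of the words.
\<close>

fun push :: "int list \<Rightarrow> int \<Rightarrow> int \<times> int list" where
  "push [] e = (e, [])"
| "push (c # f) e = (c - fst (push f e), fst (push f e) # snd (push f e))"

lemma length_push [simp]: "length (snd (push f e)) = length f"
  by (induction f) auto

lemma steps_t_step_s: "near R (cost * length f) (steps_t f + step_s e) (step_s (fst (push f e)) + steps_t (snd (push f e)))"
proof (induction f)
  case (Cons c f)
  let ?e = "fst (push f e)" and ?f = "snd (push f e)"
  have "near R (cost * length f) (step_t c + (steps_t f + step_s e)) (step_t c + (step_s ?e + steps_t ?f))"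
    by (intro near_add_left Cons)
  moreover have "near R cost ((step_t c + step_s ?e) + steps_t ?f) ((step_s (c - ?e) + step_t ?e) + steps_t ?f)"
    by (intro near_add_right exchange_steps)
  ultimately have "near R (cost * length f + cost) (step_t c + (steps_t f + step_s e)) ((step_s (c - ?e) + step_t ?e) + steps_t ?f)"
    using near_trans by (simp only: add.assoc)
  then show ?case
    by (simp add: add.assoc add.commute)
qed simp

lemma push_add:
  "length f = length g \<Longrightarrow>
    push (map2 (+) f g) (d + e) =
      (fst (push f d) + fst (push g e), map2 (+) (snd (push f d)) (snd (push g e)))"
  by (induction f g rule: list_induct2) auto

lemma push_surj: "\<exists>e. fst (push f e) = b"
proof (induction f arbitrary: b)
  case (Cons c f)
  obtain e where "fst (push f e) = c - b"
    using Cons by blast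
  then have "fst (push (c # f) e) = b"
    by simp
  then show ?case ..
qed simp

text \<open>
  The difference of \<open>steps_t f\<close> and \<open>steps_t (f + k)\<close> depends on \<open>k\<close> only: one list \<open>d\<close> compensates for
  \<open>k\<close> behind every \<open>f\<close>.  The last step of \<open>steps_t f\<close> and the first one of \<open>steps_ts d0\<close> merge into a
  step in direction \<open>s\<close>, which is pushed to the front at linear cost.  By additivity of \<open>push\<close>, the
  digits that result from \<open>f + k\<close> differ from those that result from \<open>f\<close> by what pushing some
  amount \<open>e\<close> through \<open>k\<close> gives, and the first entry of \<open>d\<close> allows every value of \<open>e\<close>.  For the \<open>e\<close>
  that makes the difference in front vanish, the situation is the same as before, for lists shorter by
  one and with a new \<open>k\<close> that again does not depend on \<open>f\<close>.
\<close>

lemma steps_t_difference: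
  assumes "length d0 = length k"
  shows "\<exists>d. \<forall>f. length f = length k \<longrightarrow>
    near R (2 * cost * (length k)\<^sup>2) (steps_t f + steps_ts d0) (steps_t (map2 (+) f k) + steps_ts d)"
  using assms
proof (induction "length k" arbitrary: k d0)
  case 0
  then show ?case by (auto intro!: exI[of _ "[]"])
next
  case (Suc n)
  obtain k0 b where k: "k = k0 @ [b]" "length k0 = n"
    using Suc.hyps(2) by (metis append_butlast_last_id length_0_conv length_butlast diff_Suc_1 nat.distinct(1))
  obtain d1 d0' where d0: "d0 = d1 # d0'" "length d0' = n"
    using Suc.hyps(2) Suc.prems by (metis length_Suc_conv)
  obtain e where e: "fst (push k0 e) = 0"
    using push_surj by blast
  let ?k = "snd (push k0 e)"
  obtain d' where d': "\<And>f. length f = n \<Longrightarrow>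
      near R (2 * cost * n\<^sup>2) (steps_t f + steps_ts d0') (steps_t (map2 (+) f ?k) + steps_ts d')"
    using Suc.hyps(1)[of ?k d0'] k d0 by auto
  have front: "near R (1 + cost * n) (steps_t (f @ [c]) + steps_ts (x # y))
     (step_s (fst (push f (c + x))) + steps_t (snd (push f (c + x))) + steps_ts y)"
    if "length f = n" for f c x y
  proof -
    have "near R 1 (steps_t f + (step_t c + step_ts x) + steps_ts y) (steps_t f + step_s (c + x) + steps_ts y)"
      by (intro near_context step_t_step_ts)
    moreover have "near R (cost * n) (steps_t f + step_s (c + x) + steps_ts y)
       (step_s (fst (push f (c + x))) + steps_t (snd (push f (c + x))) + steps_ts y)"
      using steps_t_step_s[of f] that by (intro near_add_right) simp
    ultimately show ?thesis
      using near_trans by (fastforce simp: add.assoc)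
  qed
  \<comment> \<open>Merging with the last digits \<open>c\<close> of \<open>f\<close> and \<open>c + b\<close> of \<open>f + k\<close>, the first entries \<open>d1\<close> and
    \<open>e - b + d1\<close> give \<open>c + d1\<close> and \<open>c + d1 + e\<close>.\<close>
  let ?d = "(e - b + d1) # d'"
  show ?case
  proof (intro exI[of _ ?d] allI impI)
    fix f :: "int list"
    assume "length f = length k"
    then obtain f0 c where f: "f = f0 @ [c]" "length f0 = n"
      using Suc.hyps(2) by (metis append_butlast_last_id length_0_conv length_butlast diff_Suc_1 nat.distinct(1))
    let ?e = "fst (push f0 (c + d1))" and ?f = "snd (push f0 (c + d1))"
    have "near R (1 + cost * n) (steps_t f + steps_ts d0) (step_s ?e + steps_t ?f + steps_ts d0')"
      using front[of f0 c d1 d0'] f d0 by simp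
    moreover have "near R (2 * cost * n\<^sup>2) (step_s ?e + (steps_t ?f + steps_ts d0'))
        (step_s ?e + (steps_t (map2 (+) ?f ?k) + steps_ts d'))"
      using d'[of ?f] f by (intro near_add_left) simp
    moreover have "near R (1 + cost * n) (steps_t (map2 (+) f k) + steps_ts ?d)
        (step_s ?e + steps_t (map2 (+) ?f ?k) + steps_ts d')"
    proof -
      have eq: "c + b + (e - b + d1) = (c + d1) + e"
        by simp
      have "push (map2 (+) f0 k0) (c + b + (e - b + d1)) = (?e, map2 (+) ?f ?k)"
        unfolding eq using push_add[of f0 k0 "c + d1" e] f k e by simp
      then show ?thesis
        using front[of "map2 (+) f0 k0" "c + b" "e - b + d1" d'] f k by simp
    qed
    ultimately have "near R (1 + cost * n + 2 * cost * n\<^sup>2 + (1 + cost * n)) (steps_t f + steps_ts d0)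
        (steps_t (map2 (+) f k) + steps_ts ?d)"
      unfolding add.assoc[of "step_s ?e"] using near_trans near_sym by blast
    moreover have "1 + cost * n + 2 * cost * n\<^sup>2 + (1 + cost * n) \<le> 2 * cost * (length k)\<^sup>2"
      using cost_ge_1 unfolding Suc.hyps(2)[symmetric]
      by (simp add: power2_eq_square algebra_simps)
    ultimately show "near R (2 * cost * (length k)\<^sup>2) (steps_t f + steps_ts d0) (steps_t (map2 (+) f k) + steps_ts ?d)"
      by (rule near_mono)
  qed
qed

lemma steps_t_replicate_0: "steps_t (replicate n 0) = - nmul n t"
proof (induction n)
  case (Suc n)
  then show ?case
    by (simp only: replicate_Suc steps_t_simps step_t_def digit_0 nmul_Suc_right group_normalize)
qed simp

lemma horner_conv_steps_t: "horner f = steps_t f + - steps_t (replicate (length f) 0)"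
  by (simp add: horner_def steps_t_replicate_0)

text \<open>
  By \<open>steps_t_difference\<close>, the passage from \<open>steps_t f\<close> to \<open>steps_t (f + g)\<close> requires the same
  correction as the one from \<open>steps_t 0\<close> to \<open>steps_t g\<close>.  In \<open>horner f\<close> the correction occurs once
  in each direction and cancels, which turns \<open>horner f\<close> into \<open>steps_t (f + g) - steps_t g\<close>.
\<close>

lemma horner_add:
  assumes "length f = length g"
  shows "near R (4 * cost * (length f)\<^sup>2) (horner f + horner g) (horner (map2 (+) f g))"
proof -
  let ?n = "length f" and ?z = "replicate (length f) 0 :: int list" and ?h = "map2 (+) f g"
  obtain d where d: "\<And>f. length f = ?n \<Longrightarrow>
      near R (2 * cost * ?n\<^sup>2) (steps_t f + steps_ts ?z) (steps_t (map2 (+) f g) + steps_ts d)"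
    using steps_t_difference[of ?z g] assms by auto
  have "map2 (+) ?z g = g"
    using assms by (simp add: list_eq_iff_nth_eq)
  then have z: "near R (2 * cost * ?n\<^sup>2) (steps_t g + steps_ts d) (steps_t ?z + steps_ts ?z)"
    using d[of ?z] near_sym by fastforce
  have "near R (2 * cost * ?n\<^sup>2) (steps_t f + steps_ts ?z + - steps_ts ?z + - steps_t ?z + horner g)
     (steps_t ?h + steps_ts d + - steps_ts ?z + - steps_t ?z + horner g)"
    using d by (intro near_add_right) simp
  moreover have "near R (2 * cost * ?n\<^sup>2)
     (steps_t ?h + - steps_t g + (steps_t g + steps_ts d) + (- steps_ts ?z + - steps_t ?z + horner g))
     (steps_t ?h + - steps_t g + (steps_t ?z + steps_ts ?z) + (- steps_ts ?z + - steps_t ?z + horner g))"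
    using z by (intro near_context) simp
  ultimately have "near R (2 * cost * ?n\<^sup>2 + 2 * cost * ?n\<^sup>2) (steps_t f + (- steps_t ?z + horner g)) (steps_t ?h + (- steps_t g + horner g))"
    using near_trans by (fastforce simp only: group_normalize)
  then have "near R (2 * cost * ?n\<^sup>2 + 2 * cost * ?n\<^sup>2) (horner f + horner g) (horner ?h)"
    using assms by (simp only: horner_conv_steps_t group_normalize length_map length_zip min.idem)
  then show ?thesis
    by (simp add: mult.assoc)
qed

text \<open>
  The coefficients of \<open>y f + b\<close>.
\<close>

fun times_y :: "int \<Rightarrow> int list \<Rightarrow> int list" where
  "times_y b [] = [b]"
| "times_y b (d # f) = (b + d) # times_y d f"

lemma length_times_y [simp]: "length (times_y b f) = Suc (length f)"
  by (induction b f rule: times_y.induct) auto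

lemma step_s_steps_t:
  "near R (cost * length f) (step_s b + steps_t f) (steps_t (times_y b f) + (t + - s))"
proof (induction b f rule: times_y.induct)
  case (1 b)
  have "step_s b = step_t b + (t + - s)"
    by (simp only: step_s_def step_t_def group_normalize)
  then show ?case by simp
next
  case (2 b d f)
  have "near R cost (step_s b + step_t d + steps_t f) (step_t (b + d) + step_s d + steps_t f)"
    using near_sym[OF exchange_steps[of "b + d" d]] by (intro near_add_right) simp
  moreover have "near R (cost * length f) (step_t (b + d) + (step_s d + steps_t f))
      (step_t (b + d) + (steps_t (times_y d f) + (t + - s)))"
    by (intro near_add_left 2)
  ultimately have "near R (cost + cost * length f) (step_s b + step_t d + steps_t f)
      (step_t (b + d) + (steps_t (times_y d f) + (t + - s)))"
    unfolding add.assoc[of "step_t (b + d)"] using near_trans by blast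
  then show ?case
    by (simp add: add.assoc)
qed

lemma s_horner: "near R (2 * cost * length f) (- s + horner f) (horner (times_y 0 f) + - s)"
proof -
  let ?n = "length f"
  have "- s + horner f = step_s 0 + steps_t f + nmul ?n t"
    by (simp add: step_s_def horner_def add.assoc)
  moreover have "near R (cost * ?n) (step_s 0 + steps_t f + nmul ?n t)
      (steps_t (times_y 0 f) + (t + - s) + nmul ?n t)"
    by (intro near_add_right step_s_steps_t)
  moreover have "near R (?n * 1) (steps_t (times_y 0 f) + t + (- s + nmul ?n t))
     (steps_t (times_y 0 f) + t + (nmul ?n t + - s))"
    by (intro near_add_left near_sym[OF near_nmul_commute] t_s)
  moreover have "steps_t (times_y 0 f) + t + (nmul ?n t + - s) = horner (times_y 0 f) + - s"
    by (simp only: horner_def group_normalize length_times_y nmul.simps)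
  ultimately have "near R (cost * ?n + ?n * 1) (- s + horner f) (horner (times_y 0 f) + - s)"
    using near_trans by (metis add.assoc)
  moreover have "cost * ?n + ?n * 1 \<le> 2 * cost * ?n"
    using cost_ge_1 by simp
  ultimately show ?thesis
    by (rule near_mono)
qed

text \<open>
  Multiplication by \<open>y\<^sup>j\<close>.  It suffices that some Horner word arises: what the final one
  represents is read off from an invariant.
\<close>

lemma nmul_s_horner:
  "\<exists>f'. length f' = length f + j \<and>
    near R (j * (2 * cost * (length f + j))) (- nmul j s + horner f) (horner f' + - nmul j s)"
proof (induction j arbitrary: f)
  case 0
  show ?case by (auto intro!: exI[of _ f])
next
  case (Suc j)
  let ?f = "times_y 0 f"
  obtain f' where f': "length f' = length ?f + j"
      "near R (j * (2 * cost * (length ?f + j))) (- nmul j s + horner ?f) (horner f' + - nmul j s)"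
    using Suc by blast
  have neg: "- nmul (Suc j) s = - nmul j s + - s"
    by (simp only: nmul.simps minus_add)
  have "near R (2 * cost * length f) (- nmul j s + (- s + horner f)) (- nmul j s + (horner ?f + - s))"
    by (intro near_add_left s_horner)
  moreover have "near R (j * (2 * cost * (length ?f + j))) (- nmul j s + horner ?f + - s)
     (horner f' + - nmul j s + - s)"
    by (intro near_add_right f')
  ultimately have "near R (2 * cost * length f + j * (2 * cost * (length ?f + j)))
      (- nmul j s + (- s + horner f)) (horner f' + (- nmul j s + - s))"
    unfolding add.assoc using near_trans by blast
  then have "near R (2 * cost * length f + j * (2 * cost * (length ?f + j)))
      (- nmul (Suc j) s + horner f) (horner f' + - nmul (Suc j) s)"
    by (simp only: neg add.assoc)
  moreover have "2 * cost * length f + j * (2 * cost * (length ?f + j))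
      \<le> Suc j * (2 * cost * (length f + Suc j))"
    by (simp add: algebra_simps)
  ultimately have "near R (Suc j * (2 * cost * (length f + Suc j)))
      (- nmul (Suc j) s + horner f) (horner f' + - nmul (Suc j) s)"
    by (rule near_mono)
  then show ?case
    using f'(1) by (intro exI[of _ f']) simp
qed

lemma t_horner: "- t + horner f = horner (0 # f) + - t"
  by (simp only: horner_def steps_t_simps step_t_def digit_0 list.size(4) add_Suc_right add_0_right nmul_Suc_right group_normalize)

lemma nmul_t_horner: "- nmul i t + horner f = horner (replicate i 0 @ f) + - nmul i t"
proof (induction i arbitrary: f)
  case (Suc i)
  have "- nmul (Suc i) t + horner f = - nmul i t + (horner (0 # f) + - t)"
    by (simp only: nmul.simps minus_add add.assoc t_horner)
  also have "\<dots> = horner (replicate i 0 @ 0 # f) + (- nmul i t + - t)"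
    using Suc[of "0 # f"] by (simp only: add.assoc[symmetric])
  also have "\<dots> = horner (replicate (Suc i) 0 @ f) + - nmul (Suc i) t"
    by (simp only: nmul.simps minus_add replicate_app_Cons_same replicate_Suc append_Cons)
  finally show ?case .
qed simp

lemma horner_append_replicate_0: "horner (f @ replicate k 0) = horner f"
proof -
  have "nmul (length f + k) t = nmul k t + nmul (length f) t"
    by (simp add: add.commute flip: nmul_add)
  then show ?thesis
    by (simp only: horner_def steps_t_replicate_0 steps_t_simps length_append length_replicate group_normalize)
qed

lemma horner_replicate_0 [simp]: "horner (replicate k 0) = 0"
  using horner_append_replicate_0[of "[]" k] by (simp add: horner_def)

text \<open>
  The position \<open>t^(-i) s^(-j)\<close> of a reader: a letter \<open>a\<close> read there stands for \<open>x\<^sup>i y\<^sup>j\<close>, and the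
  letters \<open>s\<close>, \<open>t\<close> change the position.
\<close>

definition shift :: "nat \<Rightarrow> nat \<Rightarrow> 'g" where
  "shift i j = - nmul i t + - nmul j s"

lemma shift_digit:
  assumes "i + j + 1 \<le> L"
  shows "\<exists>f. length f = L \<and> near R (j * (2 * cost * (1 + j))) (shift i j + digit c) (horner f + shift i j)"
proof -
  have "horner [c] = digit c"
    by (simp add: horner_def step_t_def)
  then obtain f where f: "length f = 1 + j"
      "near R (j * (2 * cost * (1 + j))) (- nmul j s + digit c) (horner f + - nmul j s)"
    using nmul_s_horner[of "[c]" j] by auto
  let ?f = "replicate i 0 @ f"
  have "near R (j * (2 * cost * (1 + j))) (- nmul i t + (- nmul j s + digit c)) (- nmul i t + (horner f + - nmul j s))"
    by (intro near_add_left f)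
  moreover have "- nmul i t + (horner f + - nmul j s) = horner ?f + shift i j"
    unfolding shift_def add.assoc[symmetric] nmul_t_horner ..
  ultimately have "near R (j * (2 * cost * (1 + j))) (shift i j + digit c) (horner ?f + shift i j)"
    by (simp only: shift_def add.assoc)
  then show ?thesis
    using assms f(1)
    by (intro exI[of _ "?f @ replicate (L - (i + j + 1)) 0"]) (simp only: horner_append_replicate_0, simp)
qed

text \<open>
  The letters \<open>s\<close> and \<open>t\<close> only move the reader.  They are given the bound for \<open>a\<close> and a Horner word
  of \<open>0\<close>, to make the induction over the word uniform.
\<close>

lemma letter_step:
  assumes g: "g \<in> {a, - a, s, - s, t, - t}" and ij: "1 \<le> i" "1 \<le> j" "i \<le> 2 * n" "j \<le> 2 * n"
    and L: "L = 4 * n + 1"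
  shows "\<exists>e i' j'. length e = L \<and> i \<le> Suc i' \<and> i' \<le> Suc i \<and> j \<le> Suc j' \<and> j' \<le> Suc j \<and>
    near R (4 * cost * L\<^sup>2) (shift i j + g) (horner e + shift i' j')"
proof -
  have "j * (2 * cost * (1 + j)) + 1 \<le> 4 * cost * L\<^sup>2"
  proof -
    have "j * (1 + j) \<le> L * L"
      using ij L by (intro mult_le_mono) auto
    then have "2 * cost * (j * (1 + j)) \<le> 2 * cost * (L * L)"
      by (rule mult_le_mono2)
    moreover have "1 \<le> 2 * cost * (L * L)"
      using cost_ge_1 L by simp
    moreover have "j * (2 * cost * (1 + j)) = 2 * cost * (j * (1 + j))"
      by (simp only: ac_simps)
    moreover have "4 * cost * L\<^sup>2 = 2 * cost * (L * L) + 2 * cost * (L * L)"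
      by (simp add: power2_eq_square)
    ultimately show ?thesis
      by linarith
  qed
  moreover have "j * 1 \<le> j * (2 * cost * (1 + j))"
    using cost_ge_1 by (intro mult_le_mono2) simp
  ultimately have bounds: "j * (2 * cost * (1 + j)) + 1 \<le> 4 * cost * L\<^sup>2" "j \<le> 4 * cost * L\<^sup>2"
    by linarith+
  have X_t: "near R (4 * cost * L\<^sup>2) (shift i j + t) (shift (i - 1) j)"
  proof -
    have "near R 1 (- s + t) (t + - s)"
      using t_s by (rule near_sym)
    then have "near R (j * 1) (- nmul j s + t) (t + - nmul j s)"
      using near_nmul_commute[of R 1 "- s" t j] by (simp add: nmul_uminus)
    then have "near R (j * 1) (- nmul i t + (- nmul j s + t)) (- nmul i t + (t + - nmul j s))"
      by (rule near_add_left)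
    moreover have "- nmul i t = - nmul (i - 1) t + - t"
      using ij(1) by (cases i) (simp_all only: nmul.simps minus_add, simp_all)
    ultimately have "near R j (shift i j + t) (shift (i - 1) j)"
      by (simp add: shift_def group_normalize del: add_uminus_conv_diff)
    then show ?thesis
      using bounds(2) by (rule near_mono)
  qed
  have X_t': "near R (4 * cost * L\<^sup>2) (shift i j + - t) (shift (Suc i) j)"
  proof -
    have "near R 1 (- s + - t) (- t + - s)"
      using near_context[OF t_s, of "- t" "- t"] by (simp only: group_normalize)
    then have "near R (j * 1) (- nmul j s + - t) (- t + - nmul j s)"
      using near_nmul_commute[of R 1 "- s" "- t" j] by (simp only: nmul_uminus)
    then have "near R (j * 1) (- nmul i t + (- nmul j s + - t)) (- nmul i t + (- t + - nmul j s))"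
      by (rule near_add_left)
    then have "near R j (shift i j + - t) (shift (Suc i) j)"
      by (simp only: shift_def group_normalize nmul.simps mult_1_right)
    then show ?thesis
      using bounds(2) by (rule near_mono)
  qed
  have X_s: "shift i j + s = shift i (j - 1)"
  proof -
    have "- nmul j s = - nmul (j - 1) s + - s"
      using ij(2) by (cases j) (simp_all only: nmul.simps minus_add, simp_all)
    then show ?thesis
      by (simp only: shift_def group_normalize)
  qed
  have X_s': "shift i j + - s = shift i (Suc j)"
    by (simp only: shift_def group_normalize nmul.simps)
  have a_case: "\<exists>e. length e = L \<and> near R (4 * cost * L\<^sup>2) (shift i j + g) (horner e + shift i j)"
    if "near R 1 g (digit c)" for c
  proof -
    obtain e where "length e = L" "near R (j * (2 * cost * (1 + j))) (shift i j + digit c) (horner e + shift i j)"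
      using shift_digit[of i j L c] ij L by auto
    moreover have "near R 1 (shift i j + g) (shift i j + digit c)"
      using that by (rule near_add_left)
    ultimately have "near R (4 * cost * L\<^sup>2) (shift i j + g) (horner e + shift i j)"
      using near_trans'[of R 1 _ _ "j * (2 * cost * (1 + j))"] bounds(1) by fastforce
    then show ?thesis
      using \<open>length e = L\<close> by blast
  qed
  have no_a: ?thesis
    if "near R (4 * cost * L\<^sup>2) (shift i j + g) (shift i' j')"
      "i \<le> Suc i'" "i' \<le> Suc i" "j \<le> Suc j'" "j' \<le> Suc j" for i' j'
    using that by (intro exI[of _ "replicate L 0"] exI[of _ i'] exI[of _ j']) simp
  consider "g = a" | "g = - a" | "g = s" | "g = - s" | "g = t" | "g = - t"
    using g by blast
  then show ?thesis
  proof cases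
    case 1
    then have "near R 1 g (digit 1)"
      by (simp add: digit_1)
    from a_case[OF this] show ?thesis
      by (metis le_SucI order_refl)
  next
    case 2
    then have "near R 1 g (digit (- 1))"
      using near_sym[OF digit_uminus[of 1]] by (simp add: digit_1)
    from a_case[OF this] show ?thesis
      by (metis le_SucI order_refl)
  next
    case 3
    then show ?thesis using no_a[of i "j - 1"] X_s by simp
  next
    case 4
    then show ?thesis using no_a[of i "Suc j"] X_s' by simp
  next
    case 5
    then show ?thesis using no_a[of "i - 1" j] X_t by simp
  next
    case 6
    then show ?thesis using no_a[of "Suc i" j] X_t' by simp
  qed
qed

text \<open>
  The bounds on \<open>i\<close> and \<open>j\<close> keep the reader at non-negative exponents until the word is
  exhausted, so that only polynomials with at most \<open>4 n + 1\<close> coefficients occur.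
\<close>

lemma collect_letters:
  assumes "set gs \<subseteq> {a, - a, s, - s, t, - t}" "L = 4 * n + 1"
    and "length gs \<le> i" "length gs \<le> j" "length gs + i \<le> 2 * n" "length gs + j \<le> 2 * n"
  shows "\<exists>f i' j'. length f = L \<and>
    near R (length gs * (8 * cost * L\<^sup>2)) (shift i j + sum_list gs) (horner f + shift i' j')"
  using assms
proof (induction gs arbitrary: i j)
  case Nil
  show ?case by (intro exI[of _ "replicate L 0"] exI[of _ i] exI[of _ j]) simp
next
  case (Cons g gs)
  obtain e i1 j1 where e: "length e = L" "i \<le> Suc i1" "i1 \<le> Suc i" "j \<le> Suc j1" "j1 \<le> Suc j"
    "near R (4 * cost * L\<^sup>2) (shift i j + g) (horner e + shift i1 j1)"
    using letter_step[of g i j n L] Cons.prems by auto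
  obtain f i' j' where f: "length f = L"
    "near R (length gs * (8 * cost * L\<^sup>2)) (shift i1 j1 + sum_list gs) (horner f + shift i' j')"
    using Cons.IH[of i1 j1] Cons.prems e by auto
  have "near R (4 * cost * L\<^sup>2) (shift i j + g + sum_list gs) (horner e + shift i1 j1 + sum_list gs)"
    by (intro near_add_right e)
  moreover have "near R (length gs * (8 * cost * L\<^sup>2)) (horner e + (shift i1 j1 + sum_list gs)) (horner e + (horner f + shift i' j'))"
    by (intro near_add_left f)
  moreover have "near R (4 * cost * L\<^sup>2) (horner e + horner f + shift i' j') (horner (map2 (+) e f) + shift i' j')"
    using horner_add[of e f] e f by (intro near_add_right) simp
  ultimately have "near R (4 * cost * L\<^sup>2 + length gs * (8 * cost * L\<^sup>2) + 4 * cost * L\<^sup>2)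
     (shift i j + (g + sum_list gs)) (horner (map2 (+) e f) + shift i' j')"
    unfolding add.assoc[where 'a = 'g] using near_trans by blast
  moreover have "4 * cost * L\<^sup>2 + length gs * (8 * cost * L\<^sup>2) + 4 * cost * L\<^sup>2
      = length (g # gs) * (8 * cost * L\<^sup>2)"
    by simp
  ultimately show ?case
    using e(1) f(1) by (intro exI[of _ "map2 (+) e f"] exI[of _ i'] exI[of _ j']) simp
qed

end

section \<open>An invariant with values in Laurent series\<close>

text \<open>
  The inverse of \<open>y\<close> has to be given explicitly, as the integers are not a field.  Series over the
  integers serve every \<open>m\<close> at once: the relator \<open>a^m\<close> takes the value \<open>m\<close> in them, and null
  words take values divisible by \<open>m\<close>.
\<close>

definition yinv :: "int fls" where
  "yinv = fps_to_fls (Abs_fps (\<lambda>n. (- 1) ^ n))"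

lemma y_yinv: "(1 + fls_X) * yinv = 1"
proof -
  have "(1 + fps_X) * Abs_fps (\<lambda>n. (- 1) ^ n) = (1 :: int fps)"
  proof (rule fps_ext)
    fix n
    show "((1 + fps_X) * Abs_fps (\<lambda>n. (- 1) ^ n)) $ n = (1 :: int fps) $ n"
      by (cases n) (simp_all add: distrib_right)
  qed
  then have "fps_to_fls ((1 + fps_X) * Abs_fps (\<lambda>n. (- 1) ^ n)) = (1 :: int fls)"
    by simp
  then show ?thesis
    unfolding yinv_def by (simp add: fls_times_fps_to_fls)
qed

fun letter_mu :: "ast \<times> bool \<Rightarrow> int fls" where
  "letter_mu (Gen_a, b) = 1"
| "letter_mu (Gen_s, b) = (if b then yinv else 1 + fls_X)"
| "letter_mu (Gen_t, b) = (if b then fls_X_inv else fls_X)"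

fun letter_der :: "ast \<times> bool \<Rightarrow> int fls" where
  "letter_der (Gen_a, b) = (if b then 1 else - 1)"
| "letter_der (Gen_s, b) = 0"
| "letter_der (Gen_t, b) = 0"

text \<open>
  The value of a word at \<open>a = 1\<close>, \<open>s = 1/y\<close>, \<open>t = 1/x\<close>, and the Fox derivative with respect to
  \<open>a\<close>, evaluated there.  With this choice \<open>a^t = t\<^sup>-\<^sup>1 a t\<close> has derivative \<open>x\<close>.
\<close>

primrec word_mu :: "ast word \<Rightarrow> int fls" where
  "word_mu [] = 1"
| "word_mu (l # w) = letter_mu l * word_mu w"

primrec word_der :: "ast word \<Rightarrow> int fls" where
  "word_der [] = 0"
| "word_der (l # w) = letter_der l + letter_mu l * word_der w"

primrec word_expo :: "ast \<Rightarrow> ast word \<Rightarrow> int" where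
  "word_expo x [] = 0"
| "word_expo x (l # w) = (if fst l = x then if snd l then 1 else - 1 else 0) + word_expo x w"

lemma freely_equal_invariant:
  assumes "freely_equal u v" and "\<And>u v. cancel u v \<Longrightarrow> F u = F v"
  shows "F u = F v"
  using assms(1) unfolding freely_equal_def
  by (induction rule: equivclp_induct) (auto dest: assms(2))

lemma word_mu_append: "word_mu (u @ v) = word_mu u * word_mu v"
  by (induction u) (simp_all add: mult.assoc)

lemma word_der_append: "word_der (u @ v) = word_der u + word_mu u * word_der v"
  by (induction u) (simp_all add: algebra_simps)

lemma word_expo_append: "word_expo x (u @ v) = word_expo x u + word_expo x v"
  by (induction u) simp_all

lemma letter_mu_inverse: "letter_mu l * letter_mu (inv_letter l) = 1"
  using y_yinv
  by (cases l rule: letter_mu.cases) (auto simp: inv_letter_def mult.commute fls_X_times_conv_shift)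

lemma letter_der_inverse: "letter_der l + letter_mu l * letter_der (inv_letter l) = 0"
  by (cases l rule: letter_mu.cases) (auto simp: inv_letter_def)

lift_definition mu :: "ast fgrp \<Rightarrow> int fls" is word_mu
proof (erule freely_equal_invariant)
  fix u v :: "ast word"
  assume "cancel u v"
  then show "word_mu u = word_mu v"
  proof cases
    case (1 u l v)
    then show ?thesis
      using letter_mu_inverse[of l] by (simp add: word_mu_append mult.assoc[symmetric])
  qed
qed

lift_definition der :: "ast fgrp \<Rightarrow> int fls" is word_der
proof (erule freely_equal_invariant)
  fix u v :: "ast word"
  assume "cancel u v"
  then show "word_der u = word_der v"
  proof cases
    case (1 u l v)
    have "word_der ([l, inv_letter l] @ v) =
       (letter_der l + letter_mu l * letter_der (inv_letter l))
       + (letter_mu l * letter_mu (inv_letter l)) * word_der v"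
      by (simp add: algebra_simps)
    then show ?thesis
      unfolding 1 word_der_append[of u] letter_mu_inverse letter_der_inverse by simp
  qed
qed

lift_definition expo :: "ast \<Rightarrow> ast fgrp \<Rightarrow> int" is word_expo
proof (erule freely_equal_invariant)
  fix x and u v :: "ast word"
  assume "cancel u v"
  then show "word_expo x u = word_expo x v"
    by cases (simp add: word_expo_append inv_letter_def)
qed

lemma mu_add: "mu (g + h) = mu g * mu h"
  by transfer (rule word_mu_append)

lemma der_add: "der (g + h) = der g + mu g * der h"
  by transfer (rule word_der_append)

lemma expo_add: "expo x (g + h) = expo x g + expo x h"
  by transfer (rule word_expo_append)

lemma zero_values: "mu 0 = 1" "der 0 = 0" "expo x 0 = 0"
  by (transfer; simp)+

lemma mu_uminus: "mu (- g) * mu g = 1"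
  using mu_add[of "- g" g] by (simp add: zero_values)

lemma der_uminus: "der (- g) = - (mu (- g) * der g)"
  using der_add[of "- g" g] by (simp add: zero_values add_eq_0_iff2)

lemma expo_uminus: "expo x (- g) = - expo x g"
  using expo_add[of x "- g" g] by (simp add: zero_values)

definition a\<^sub>0 :: "ast fgrp" where "a\<^sub>0 = cls (gen Gen_a)"
definition s\<^sub>0 :: "ast fgrp" where "s\<^sub>0 = cls (gen Gen_s)"
definition t\<^sub>0 :: "ast fgrp" where "t\<^sub>0 = cls (gen Gen_t)"

lemma cls_singleton:
  "cls [l] = (let g = (case fst l of Gen_a \<Rightarrow> a\<^sub>0 | Gen_s \<Rightarrow> s\<^sub>0 | Gen_t \<Rightarrow> t\<^sub>0)
              in if snd l then g else - g)"
  by (cases l; cases "fst l"; cases "snd l")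
     (simp_all add: a\<^sub>0_def s\<^sub>0_def t\<^sub>0_def gen_def inv_word_def inv_letter_def flip: cls_inv_word)

lemma generator_values [simp]:
  "mu a\<^sub>0 = 1" "mu s\<^sub>0 = yinv" "mu t\<^sub>0 = fls_X_inv"
  "mu (- a\<^sub>0) = 1" "mu (- s\<^sub>0) = 1 + fls_X" "mu (- t\<^sub>0) = fls_X"
  "der a\<^sub>0 = 1" "der s\<^sub>0 = 0" "der t\<^sub>0 = 0"
  "der (- a\<^sub>0) = - 1" "der (- s\<^sub>0) = 0" "der (- t\<^sub>0) = 0"
  "expo x a\<^sub>0 = (if x = Gen_a then 1 else 0)" "expo x s\<^sub>0 = (if x = Gen_s then 1 else 0)"
  "expo x t\<^sub>0 = (if x = Gen_t then 1 else 0)"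
  unfolding a\<^sub>0_def s\<^sub>0_def t\<^sub>0_def
  by (transfer; simp add: gen_def inv_word_def inv_letter_def)+

lemma cls_pow_word: "cls (pow_word x k) = nmul k (cls x)"
  by (induction k) (simp_all add: pow_word_def cls_Nil cls_append)

lemma cls_relators:
  "cls ` Gamma_relators m =
    (let b = - t\<^sub>0 + a\<^sub>0 + t\<^sub>0 in
      {- a\<^sub>0 + - b + a\<^sub>0 + b, - s\<^sub>0 + - t\<^sub>0 + s\<^sub>0 + t\<^sub>0, - s\<^sub>0 + a\<^sub>0 + s\<^sub>0 + - (a\<^sub>0 + b), nmul m a\<^sub>0})"
  by (simp only: Gamma_relators_def Let_def relator_def comm_word_def conj_word_def cls_append
      cls_inv_word cls_pow_word a\<^sub>0_def s\<^sub>0_def t\<^sub>0_def cls_Nil image_insert image_empty group_normalize)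

lemma mu_nmul_a: "mu (nmul k a\<^sub>0) = 1"
  by (induction k) (simp_all add: mu_add zero_values)

lemma der_nmul_a: "der (nmul k a\<^sub>0) = of_nat k"
  by (induction k) (simp_all add: der_add zero_values)

lemma der_nmul_t: "der (nmul k t\<^sub>0) = 0"
  by (induction k) (simp_all add: der_add zero_values)

lemma expo_nmul: "expo x (nmul k g) = int k * expo x g"
  by (induction k) (simp_all add: expo_add zero_values algebra_simps)

lemma relator_values:
  assumes "r \<in> cls ` Gamma_relators m"
  shows "mu r = 1 \<and> (\<exists>h. der r = of_nat m * h) \<and> expo Gen_s r = 0 \<and> expo Gen_t r = 0"
proof -
  let ?b = "- t\<^sub>0 + a\<^sub>0 + t\<^sub>0"
  have x: "fls_X * fls_X_inv = (1 :: int fls)" and y: "(1 + fls_X) * yinv = 1"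
    using mu_uminus[of t\<^sub>0] mu_uminus[of s\<^sub>0] by simp_all
  have b: "mu ?b = 1" "der ?b = fls_X"
    using x by (simp_all add: mu_add der_add)
  then have b': "mu (- ?b) = 1" "der (- ?b) = - fls_X"
    using mu_uminus[of ?b] der_uminus[of ?b] by simp_all
  have ab: "mu (a\<^sub>0 + ?b) = 1" "der (a\<^sub>0 + ?b) = 1 + fls_X"
    using b by (simp_all only: mu_add der_add) simp_all
  then have ab': "mu (- (a\<^sub>0 + ?b)) = 1" "der (- (a\<^sub>0 + ?b)) = - (1 + fls_X)"
    using mu_uminus[of "a\<^sub>0 + ?b"] der_uminus[of "a\<^sub>0 + ?b"] by simp_all
  have as: "mu (- s\<^sub>0 + a\<^sub>0 + s\<^sub>0) = 1" "der (- s\<^sub>0 + a\<^sub>0 + s\<^sub>0) = 1 + fls_X"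
    using y by (simp_all add: mu_add der_add)
  have 1: "mu (- a\<^sub>0 + - ?b + a\<^sub>0 + ?b) = 1" "der (- a\<^sub>0 + - ?b + a\<^sub>0 + ?b) = 0"
    unfolding mu_add[of _ "?b"] mu_add[of _ "- ?b"] mu_add[of _ a\<^sub>0]
      der_add[of _ "?b"] der_add[of _ "- ?b"] der_add[of _ a\<^sub>0] b b' by simp_all
  have "mu (- s\<^sub>0 + - t\<^sub>0 + s\<^sub>0 + t\<^sub>0) = ((1 + fls_X) * yinv) * (fls_X * fls_X_inv)"
    by (simp only: mu_add generator_values ac_simps)
  then have 2: "mu (- s\<^sub>0 + - t\<^sub>0 + s\<^sub>0 + t\<^sub>0) = 1" "der (- s\<^sub>0 + - t\<^sub>0 + s\<^sub>0 + t\<^sub>0) = 0"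
    unfolding x y by (simp_all only: der_add generator_values) simp_all
  have 3: "mu (- s\<^sub>0 + a\<^sub>0 + s\<^sub>0 + - (a\<^sub>0 + ?b)) = 1" "der (- s\<^sub>0 + a\<^sub>0 + s\<^sub>0 + - (a\<^sub>0 + ?b)) = 0"
    unfolding mu_add[of _ "- (a\<^sub>0 + ?b)"] der_add[of _ "- (a\<^sub>0 + ?b)"] as ab' by simp_all
  have 4: "mu (nmul m a\<^sub>0) = 1" "der (nmul m a\<^sub>0) = of_nat m * 1"
    by (simp_all add: mu_nmul_a der_nmul_a)
  have "der r = of_nat m * 0 \<or> der r = of_nat m * 1" "mu r = 1"
    using assms 1 2 3 4 unfolding cls_relators Let_def by auto
  moreover have "expo Gen_s r = 0" "expo Gen_t r = 0"
    using assms unfolding cls_relators Let_def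
    by (auto simp: expo_add expo_uminus expo_nmul simp del: add_uminus_conv_diff)
  ultimately show ?thesis
    by blast
qed

text \<open>
  The derivative of a conjugate \<open>- u + r + u\<close> is \<open>mu (- u) * der r\<close> if \<open>mu r = 1\<close>, because the
  contributions of \<open>- u\<close> and \<open>u\<close> cancel.
\<close>

lemma conj_prod_values:
  assumes "conj_prod (cls ` Gamma_relators m) n g"
  shows "mu g = 1 \<and> (\<exists>h. der g = of_nat m * h) \<and> expo Gen_s g = 0 \<and> expo Gen_t g = 0"
  using assms
proof (induction rule: conj_prod.induct)
  case zero
  show ?case by (auto simp: zero_values intro: exI[of _ 0])
next
  case (pos r n g u)
  obtain h h' where h: "der r = of_nat m * h" "der g = of_nat m * h'"
    using pos relator_values by blast
  have r: "mu r = 1" "expo Gen_s r = 0" "expo Gen_t r = 0"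
    using pos relator_values by blast+
  have "der (- u + r + u + g) = of_nat m * (mu (- u) * h + h')"
    using r h mu_uminus[of u] pos.IH by (simp add: der_add mu_add der_uminus algebra_simps)
  then show ?case
    using r pos.IH mu_uminus[of u] by (auto simp: mu_add expo_add expo_uminus)
next
  case (neg r n g u)
  obtain h h' where h: "der r = of_nat m * h" "der g = of_nat m * h'"
    using neg relator_values by blast
  have r: "mu r = 1" "expo Gen_s r = 0" "expo Gen_t r = 0"
    using neg relator_values by blast+
  have r': "mu (- r) = 1" "der (- r) = of_nat m * (- h)" "expo Gen_s (- r) = 0" "expo Gen_t (- r) = 0"
    using mu_uminus[of r] der_uminus[of r] r h by (simp_all add: expo_uminus)
  have "der (- u + - r + u + g) = of_nat m * (mu (- u) * - h + h')"
    using r' h mu_uminus[of u] neg.IH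
    by (simp add: der_add mu_add der_uminus[of u] algebra_simps del: add_uminus_conv_diff)
  then show ?case
    using r' neg.IH mu_uminus[of u]
    by (auto simp: mu_add expo_add expo_uminus[of _ u] simp del: add_uminus_conv_diff)
qed

lemma near_expo:
  assumes "near (cls ` Gamma_relators m) N g h" "x \<noteq> Gen_a"
  shows "expo x g = expo x h"
proof -
  obtain n where "conj_prod (cls ` Gamma_relators m) n (g + - h)"
    using assms(1) unfolding near_def by auto
  from conj_prod_values[OF this] have "expo x (g + - h) = 0"
    using assms(2) by (cases x) auto
  then show ?thesis
    by (simp only: expo_add expo_uminus)
qed

lemma baumslag_relations:
  assumes "m \<ge> 2"
  shows "baumslag_relations (cls ` Gamma_relators m) a\<^sub>0 s\<^sub>0 t\<^sub>0 m"
proof -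
  let ?R = "cls ` Gamma_relators m" and ?b = "- t\<^sub>0 + a\<^sub>0 + t\<^sub>0"
  have rel: "near ?R 1 r 0" if "r \<in> ?R" for r
    using that by (intro near_relator) simp
  have "near ?R 1 (- a\<^sub>0 + - ?b + a\<^sub>0 + ?b) 0"
    by (rule rel) (simp add: cls_relators Let_def)
  from near_add_left[OF this, of "?b + a\<^sub>0"] have 1: "near ?R 1 (a\<^sub>0 + ?b) (?b + a\<^sub>0)"
    by (simp only: group_normalize)
  have "near ?R 1 (- s\<^sub>0 + - t\<^sub>0 + s\<^sub>0 + t\<^sub>0) 0"
    by (rule rel) (simp add: cls_relators Let_def)
  from near_add_left[OF this, of "t\<^sub>0 + s\<^sub>0"] have 2: "near ?R 1 (s\<^sub>0 + t\<^sub>0) (t\<^sub>0 + s\<^sub>0)"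
    by (simp only: group_normalize)
  have "near ?R 1 (- s\<^sub>0 + a\<^sub>0 + s\<^sub>0 + - (a\<^sub>0 + ?b)) 0"
    by (rule rel) (simp add: cls_relators Let_def)
  from near_add_right[OF this, of "a\<^sub>0 + ?b"] have 3: "near ?R 1 (- s\<^sub>0 + a\<^sub>0 + s\<^sub>0) (a\<^sub>0 + ?b)"
    by (simp only: group_normalize)
  have 4: "near ?R 1 (nmul m a\<^sub>0) 0"
    by (rule rel) (simp add: cls_relators Let_def)
  show ?thesis
    using assms 1 2 3 4 by unfold_locales (simp_all only: add.assoc)
qed

section \<open>The Dehn function\<close>

context
  fixes m :: nat
  assumes m: "m \<ge> 2"
begin

interpretation baumslag_relations "cls ` Gamma_relators m" a\<^sub>0 s\<^sub>0 t\<^sub>0 m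
  by (rule baumslag_relations[OF m])

primrec digit_series :: "int list \<Rightarrow> int fps" where
  "digit_series [] = 0"
| "digit_series (c # f) = fps_const (c mod int m) + fps_X * digit_series f"

lemma digit_series_nth: "i < length f \<Longrightarrow> digit_series f $ i = f ! i mod int m"
  by (induction f arbitrary: i) (auto simp: nth_Cons split: nat.split)

lemma der_steps_t: "der (steps_t f) = fps_to_fls (digit_series f)"
proof (induction f)
  case (Cons c f)
  have "der (step_t c) = of_nat (nat (c mod int m))" "mu (step_t c) = fls_X"
    unfolding step_t_def digit_def diff_conv_add_uminus der_add mu_add
    by (simp_all add: der_nmul_a mu_nmul_a)
  moreover have "of_nat (nat (c mod int m)) = fls_const (c mod int m)"
    using m by (simp add: fls_of_nat)
  ultimately show ?case
    using Cons by (simp add: der_add fls_times_fps_to_fls)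
qed (simp add: zero_values)

text \<open>
  The Fox derivative of a Horner word is a power series whose coefficients are the digits.  For a
  null word these are multiples of \<open>m\<close> below \<open>m\<close>.
\<close>

lemma horner_eq_0_of_near:
  assumes "near (cls ` Gamma_relators m) N (horner f) 0"
  shows "horner f = 0"
proof -
  obtain n where "conj_prod (cls ` Gamma_relators m) n (horner f)"
    using assms unfolding near_def by auto
  then obtain h where "der (horner f) = of_nat m * h"
    using conj_prod_values by blast
  then have h: "fps_to_fls (digit_series f) = of_nat m * h"
    by (simp add: horner_def der_add der_nmul_t der_steps_t)
  have "c mod int m = 0" if "c \<in> set f" for c
  proof -
    obtain i where i: "i < length f" "c = f ! i"
      using \<open>c \<in> set f\<close> by (metis in_set_conv_nth)
    have "c mod int m = fls_nth (fps_to_fls (digit_series f)) (int i)"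
      using i by (simp add: digit_series_nth)
    also have "\<dots> = int m * fls_nth h (int i)"
      unfolding h by (simp add: fls_of_nat)
    finally have "int m dvd c mod int m"
      by simp
    then show ?thesis
      by (simp add: dvd_mod_iff)
  qed
  then have "map step_t f = map (\<lambda>_. step_t 0) f"
    by (intro map_cong) (auto simp: step_t_def digit_def)
  then have "steps_t f = steps_t (replicate (length f) 0)"
    unfolding steps_t_def by (simp add: map_replicate_const)
  then show ?thesis
    by (simp add: horner_conv_steps_t)
qed

lemma expo_horner: "expo Gen_s (horner f) = 0" "expo Gen_t (horner f) = 0"
proof -
  have "expo Gen_s (step_t c) = 0" "expo Gen_t (step_t c) = - 1" for c
    unfolding step_t_def digit_def diff_conv_add_uminus expo_add expo_uminus expo_nmul by simp_all
  then have "expo Gen_s (steps_t f) = 0" "expo Gen_t (steps_t f) = - int (length f)"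
    by (induction f) (simp_all add: zero_values expo_add)
  then show "expo Gen_s (horner f) = 0" "expo Gen_t (horner f) = 0"
    by (simp_all add: horner_def expo_add expo_nmul)
qed

lemma sum_list_letters: "sum_list (map (\<lambda>l. cls [l]) w) = cls w"
  by (induction w) (simp_all add: cls_Nil flip: cls_append)

text \<open>
  The exponent sums of \<open>s\<close> and \<open>t\<close> in \<open>w\<close> vanish, so the reader comes back to its starting point; what
  remains of \<open>w\<close> is a conjugate of a null Horner word, which is freely trivial.
\<close>

lemma area_bound:
  assumes "represents_one (Gamma_relators m) w" "length w \<le> n"
  shows "area (Gamma_relators m) w \<le> n * (8 * cost * (4 * n + 1)\<^sup>2)"
proof -
  let ?R = "cls ` Gamma_relators m"
  let ?gs = "map (\<lambda>l. cls [l]) w"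
  let ?D = "length w * (8 * cost * (4 * n + 1)\<^sup>2)"
  have "cls [l] \<in> {a\<^sub>0, - a\<^sub>0, s\<^sub>0, - s\<^sub>0, t\<^sub>0, - t\<^sub>0}" for l
    by (cases "fst l") (simp_all add: cls_singleton)
  then have "set ?gs \<subseteq> {a\<^sub>0, - a\<^sub>0, s\<^sub>0, - s\<^sub>0, t\<^sub>0, - t\<^sub>0}"
    by (simp only: set_map image_subset_iff) blast
  then obtain f i j where near_w: "near ?R ?D (shift n n + cls w) (horner f + shift i j)"
    using collect_letters[of ?gs "4 * n + 1" n n n] assms(2) by (auto simp: sum_list_letters)
  obtain N where N: "near ?R N (cls w) 0"
    using near_of_represents_one[OF assms(1)] by blast
  have shift_expo: "expo Gen_t (shift i j) = - int i" "expo Gen_s (shift i j) = - int j" for i j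
    by (simp_all add: shift_def expo_add expo_uminus expo_nmul del: add_uminus_conv_diff)
  have "expo Gen_t (cls w) = 0" "expo Gen_s (cls w) = 0"
    using near_expo[OF N] by (simp_all add: zero_values)
  then have ij: "i = n" "j = n"
    using near_expo[OF near_w, of Gen_t] near_expo[OF near_w, of Gen_s]
    by (simp_all add: expo_add expo_horner shift_expo)
  have "near ?R (?D + N) (horner f + shift n n) (shift n n + 0)"
    using near_trans[OF near_sym[OF near_w] near_add_left[OF N]] unfolding ij .
  from near_add_right[OF this, of "- shift n n"] have "near ?R (?D + N) (horner f) 0"
    by (simp only: group_normalize)
  then have "horner f = 0"
    by (rule horner_eq_0_of_near)
  then have "near ?R ?D (- shift n n + (shift n n + cls w)) (- shift n n + shift n n)"
    using near_w ij by (intro near_add_left) simp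
  then have "near ?R ?D (cls w) 0"
    by (simp only: group_normalize)
  then have "area (Gamma_relators m) w \<le> ?D"
    by (rule area_le_of_near)
  also have "\<dots> \<le> n * (8 * cost * (4 * n + 1)\<^sup>2)"
    using assms(2) by (rule mult_le_mono1)
  finally show ?thesis .
qed

lemma dehn_function_bound:
  "dehn_function (Gamma_relators m) n \<le> n * (8 * cost * (4 * n + 1)\<^sup>2)"
  unfolding dehn_function_def
proof (rule Max.boundedI)
  show "finite (area (Gamma_relators m) ` {w. length w \<le> n \<and> represents_one (Gamma_relators m) w})"
    by (intro finite_imageI finite_null_words)
  show "area (Gamma_relators m) ` {w. length w \<le> n \<and> represents_one (Gamma_relators m) w} \<noteq> {}"
    using represents_one_Nil[of "Gamma_relators m"] by (auto intro!: exI[of _ "[]"])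
  fix k
  assume "k \<in> area (Gamma_relators m) ` {w. length w \<le> n \<and> represents_one (Gamma_relators m) w}"
  then show "k \<le> n * (8 * cost * (4 * n + 1)\<^sup>2)"
    using area_bound by blast
qed

lemma dehn_function_le_quartic: "dehn_function (Gamma_relators m) \<preceq> (\<lambda>n. n ^ 4)"
  unfolding asymp_le_def
proof (intro exI conjI allI)
  let ?C = "128 * cost"
  show "?C > 0"
    using cost_ge_1 by simp
  have quartic: "N\<^sup>2 * (8 * cost * (4 * N)\<^sup>2) = ?C * N ^ 4" for N :: nat
    by (simp add: power2_eq_square power4_eq_xxxx)
  fix n
  have "dehn_function (Gamma_relators m) n \<le> n * (8 * cost * (4 * n + 1)\<^sup>2)"
    by (rule dehn_function_bound)
  also have "\<dots> \<le> (n + 1)\<^sup>2 * (8 * cost * (4 * (n + 1))\<^sup>2)"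
    by (intro mult_le_mono power_mono) (simp_all add: power2_eq_square)
  also have "\<dots> = ?C * (n + 1) ^ 4"
    by (rule quartic)
  also have "\<dots> \<le> ?C * (?C * n + ?C) ^ 4"
  proof (intro mult_le_mono2 power_mono)
    have "1 * (n + 1) \<le> ?C * (n + 1)"
      using cost_ge_1 by (intro mult_le_mono1) simp
    then show "n + 1 \<le> ?C * n + ?C"
      by simp
  qed simp
  also have "\<dots> \<le> ?C * (?C * n + ?C) ^ 4 + ?C * n + ?C"
    by simp
  finally show "dehn_function (Gamma_relators m) n \<le> ?C * (?C * n + ?C) ^ 4 + ?C * n + ?C" .
qed

end

theorem theorem1p2:
  fixes m :: nat
  assumes "m \<ge> 2"
  shows "dehn_function (Gamma_relators m) \<preceq> (\<lambda>n. n ^ 4)"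
  using assms by (rule dehn_function_le_quartic)

end
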